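(* Let $A \in \mathbb{R}^{m \times n}$ and let $p \ge 1$ be an integer. For every integer $k \ge p$, let $\hat\theta_{2p}$ be the estimator of $\|A\|_{2p}^{2p}$ built from a Gaussian sketch of $A$ with sketch size $k$ (defined in the context). Then, as $k \to \infty$ with $A$ and $p$ fixed, $$\mathrm{Var}(\hat\theta_{2p}) = \frac{2p^2\,\|A\|_{4p}^{4p}}{k} + \mathcal{O}\left(\frac{1}{k^2}\right),$$ where the constant in $\mathcal{O}(\cdot)$ depends on $p$ and is a symmetric function of the singular values of $A$ (and does not depend on $k$).
   Context: For a real matrix $A$ with singular values $\sigma_1,\dots,\sigma_{\min\{m,n\}}$ and an integer $q\ge 1$, the Schatten-$q$ norm is $\|A\|_q = \left(\sum_i \sigma_i^q\right)^{1/q}$. Estimator: let $\Omega \in \mathbb{R}^{n\times k}$ be a random matrix with i.i.d. standard Gaussian $N(0,1)$ entries, $Y = A\Omega$, $Z = Y^TY \in \mathbb{R}^{k\times k}$, and let $T$ be the strictly upper triangular part of $Z$ (entries on and below the diagonal set to zero). Then $$\hat\theta_{2p} = \binom{k}{p}^{-1}\mathrm{trace}(T^{p-1}Z),$$ with $T^0 = I$. Equivalently, $\hat\theta_{2p} = \binom{k}{p}^{-1}\sum_{1\le i_1<\cdots<i_p\le k} Z_{i_1 i_2}Z_{i_2i_3}\cdots Z_{i_{p-1}i_p}Z_{i_pi_1}$. The variance is over the randomness of $\Omega$. *)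

theory Defs
  imports "HOL-Probability.Probability" "Jordan_Normal_Form.Char_Poly"
begin

text \<open>
  The \<open>min m n\<close> singular values of an \<open>m \<times> n\<close> matrix, zeros included, repeated according to
  multiplicity: square roots of the eigenvalues of the smaller of the two Gram matrices.
  That matrix is symmetric and positive semidefinite, so its characteristic polynomial splits
  over the reals with nonnegative roots. Being a multiset, \<open>singular_values A\<close> carries
  no order: a symmetric function of the singular values is a function of this multiset.
\<close>

definition singular_values :: "real mat \<Rightarrow> real multiset" where
  "singular_values A =
     image_mset sqrt (proots (char_poly
       (if dim_col A \<le> dim_row A then transpose_mat A * A else A * transpose_mat A)))"

definition schatten_norm :: "nat \<Rightarrow> real mat \<Rightarrow> real" where
  "schatten_norm q A = root q (\<Sum>\<sigma>\<in>#singular_values A. \<sigma> ^ q)"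

definition standard_gaussian_matrix ::
  "nat \<Rightarrow> nat \<Rightarrow> 'w measure \<Rightarrow> ('w \<Rightarrow> real mat) \<Rightarrow> bool" where
  "standard_gaussian_matrix n k M \<Omega> \<longleftrightarrow>
     prob_space M \<and>
     (\<forall>\<omega>\<in>space M. \<Omega> \<omega> \<in> carrier_mat n k) \<and>
     prob_space.indep_vars M (\<lambda>_. borel) (\<lambda>(i, j) \<omega>. \<Omega> \<omega> $$ (i, j)) ({..<n} \<times> {..<k}) \<and>
     (\<forall>i<n. \<forall>j<k. distributed M lborel (\<lambda>\<omega>. \<Omega> \<omega> $$ (i, j)) std_normal_density)"

definition strict_upper_part :: "real mat \<Rightarrow> real mat" where
  "strict_upper_part Z = mat (dim_row Z) (dim_col Z) (\<lambda>(i, j). if i < j then Z $$ (i, j) else 0)"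

definition mat_trace :: "real mat \<Rightarrow> real" where
  "mat_trace Z = (\<Sum>i<dim_row Z. Z $$ (i, i))"

definition schatten_estimator :: "nat \<Rightarrow> real mat \<Rightarrow> real mat \<Rightarrow> real" where
  "schatten_estimator p A G =
     (let Y = A * G; Z = transpose_mat Y * Y; T = strict_upper_part Z
      in mat_trace (T ^\<^sub>m (p - 1) * Z) / real (dim_col G choose p))"

end

theory Submission
  imports Defs "Jordan_Normal_Form.Schur_Decomposition"
begin

text \<open>
  Let \<open>y\<^sub>j\<close> be the columns of \<open>A * \<Omega>\<close> and \<open>S = A * A\<^sup>T\<close>. The estimator is the average, over all
  \<open>p\<close>-subsets \<open>I\<close> of the columns, of \<open>X\<^sub>I\<close>, the trace of the ordered product of the matrices
  \<open>y\<^sub>j * y\<^sub>j\<^sup>T\<close> with \<open>j \<in> I\<close>; these factors are independent with mean \<open>S\<close>. Hence \<open>X\<^sub>I\<close> and \<open>X\<^sub>J\<close> are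
  uncorrelated for disjoint \<open>I\<close>, \<open>J\<close>, and by Isserlis' theorem their covariance is
  \<open>\<zeta> = 2 * tr (S\<^sup>2\<^sup>p)\<close> when \<open>I\<close> and \<open>J\<close> share exactly one column. For larger intersections the bound
  \<open>X\<^sub>I\<^sup>2 \<le> (\<Prod>j\<in>I. \<bar>y\<^sub>j\<bar>\<^sup>4)\<close>, from the Cauchy-Schwarz inequality, suffices, since such pairs are a
  fraction \<open>O(1/k\<^sup>2)\<close> of all pairs. All constants are traces of powers of \<open>S\<close>, which are power sums
  of the singular values by Schur triangularisation.
\<close>

section \<open>Variance of U-statistics\<close>

text \<open>When two index sets share several columns, the mixed expectation can depend on how the
  remaining indices interleave. No closed form is attempted for such pairs; a bound uniform in the
  pair is enough. With \<open>\<tau> = tr (S^p)\<close> it is \<open>K ^ p + \<tau>\<^sup>2\<close>,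
  where \<open>K\<close> is the fourth moment of the norm of one column and the power
  \<open>p\<close> comes from the independence of the columns. The factor 2 in \<zeta> counts
  Isserlis pairings. The common column contributes four entries, hence three pairings: one closes
  each trace on its own and yields the product of the means, which centring removes; the other two
  join both traces into a single cycle of length \<open>2 * p\<close>. The factor
  \<open>p^2 / k\<close> in front of \<zeta> is the mean size of the intersection of two independent
  uniform \<open>p\<close>-subsets of \<open>k\<close> columns. Since \<open>S\<close> does not
  involve \<open>k\<close>, one constant serves all sketch sizes.\<close>

lemma card_supersets:
  assumes "finite A" "S \<subseteq> A" "card S \<le> p"
  shows "card {I. I \<subseteq> A \<and> card I = p \<and> S \<subseteq> I} = (card A - card S) choose (p - card S)"
proof -
  have fS: "finite S" using assms finite_subset by blast
  have "bij_betw (\<lambda>I. I - S) {I. I \<subseteq> A \<and> card I = p \<and> S \<subseteq> I}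
          {J. J \<subseteq> A - S \<and> card J = p - card S}"
  proof (rule bij_betw_byWitness[where f' = "\<lambda>J. J \<union> S"])
    show "(\<lambda>J. J \<union> S) ` {J. J \<subseteq> A - S \<and> card J = p - card S}
            \<subseteq> {I. I \<subseteq> A \<and> card I = p \<and> S \<subseteq> I}"
    proof clarify
      fix J assume J: "J \<subseteq> A - S" "card J = p - card S"
      have "card (J \<union> S) = card J + card S"
        using J assms fS by (intro card_Un_disjoint) (auto intro: finite_subset)
      then show "J \<union> S \<subseteq> A \<and> card (J \<union> S) = p \<and> S \<subseteq> J \<union> S"
        using J assms by auto
    qed
  qed (use fS in \<open>auto simp: card_Diff_subset\<close>)
  then have "card {I. I \<subseteq> A \<and> card I = p \<and> S \<subseteq> I} = card {J. J \<subseteq> A - S \<and> card J = p - card S}"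
    by (rule bij_betw_same_card)
  also have "\<dots> = card (A - S) choose (p - card S)"
    using assms by (intro n_subsets) auto
  also have "card (A - S) = card A - card S"
    using assms fS by (simp add: card_Diff_subset)
  finally show ?thesis .
qed

text \<open>A given index lies in a fraction \<open>p / k\<close> of the \<open>p\<close>-subsets.
  This is the absorption identity for binomial coefficients, kept in multiplied-out form.\<close>

lemma sum_indicator_supersets:
  assumes "i < k" "1 \<le> p"
  defines "F \<equiv> {I. I \<subseteq> {..<k} \<and> card I = p}"
  shows "real k * (\<Sum>I\<in>F. of_bool (i \<in> I)) = real p * real (k choose p)"
proof -
  have fin: "finite F" unfolding F_def by (rule finite_subset[of _ "Pow {..<k}"]) auto
  have "(\<Sum>I\<in>F. of_bool (i \<in> I) :: real) = real (card {I \<in> F. i \<in> I})"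
    using fin by (simp add: of_bool_def sum.If_cases Int_def)
  also have "{I \<in> F. i \<in> I} = {I. I \<subseteq> {..<k} \<and> card I = p \<and> {i} \<subseteq> I}"
    by (auto simp: F_def)
  also have "card \<dots> = (k - 1) choose (p - 1)"
    using assms by (subst card_supersets) auto
  finally have "real k * (\<Sum>I\<in>F. of_bool (i \<in> I)) = real (k * ((k - 1) choose (p - 1)))"
    by simp
  also have "k * ((k - 1) choose (p - 1)) = p * (k choose p)"
    using times_binomial_minus1_eq[of p k] assms by simp
  finally show ?thesis by simp
qed

text \<open>Absorption applied twice. Together with the count for one index this gives the first two
  moments of the size of an intersection.\<close>

lemma sum_indicator_pair_supersets:
  assumes "i < k" "j < k" "i \<noteq> j" "1 \<le> p"
  defines "F \<equiv> {I. I \<subseteq> {..<k} \<and> card I = p}"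
  shows "real k * (real k - 1) * (\<Sum>I\<in>F. of_bool (i \<in> I \<and> j \<in> I))
           = real p * (real p - 1) * real (k choose p)"
proof -
  have fin: "finite F" unfolding F_def by (rule finite_subset[of _ "Pow {..<k}"]) auto
  have eq: "(\<Sum>I\<in>F. of_bool (i \<in> I \<and> j \<in> I) :: real) = real (card {I \<in> F. i \<in> I \<and> j \<in> I})"
    using fin by (simp add: of_bool_def sum.If_cases Int_def)
  have set_eq: "{I \<in> F. i \<in> I \<and> j \<in> I} = {I. I \<subseteq> {..<k} \<and> card I = p \<and> {i, j} \<subseteq> I}"
    by (auto simp: F_def)
  show ?thesis
  proof (cases "p = 1")
    case True
    \<comment> \<open>No singleton contains two distinct indices, so both sides vanish. The formula
      of the other case would fail here: \<open>p - 2\<close> truncates to 0 and the binomial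
      coefficient becomes 1.\<close>
    have "{I. I \<subseteq> {..<k} \<and> card I = p \<and> {i, j} \<subseteq> I} = {}"
      using True assms(3) by (auto simp: card_1_singleton_iff)
    then show ?thesis using True by (simp add: eq set_eq)
  next
    case False
    then have p: "p \<ge> 2" using assms by simp
    have k: "k \<ge> 2" using assms by simp
    have "card {I \<in> F. i \<in> I \<and> j \<in> I} = (k - 2) choose (p - 2)"
      unfolding set_eq using assms p by (subst card_supersets) (auto simp: numeral_2_eq_2)
    moreover have "k * (k - 1) * ((k - 2) choose (p - 2)) = p * (p - 1) * (k choose p)"
    proof -
      have "k * ((k - 1) * ((k - 2) choose (p - 2))) = k * ((p - 1) * ((k - 1) choose (p - 1)))"
        using times_binomial_minus1_eq[of "p - 1" "k - 1"] p by (simp add: numeral_2_eq_2)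
      also have "\<dots> = (p - 1) * (k * ((k - 1) choose (p - 1)))" by simp
      also have "k * ((k - 1) choose (p - 1)) = p * (k choose p)"
        using times_binomial_minus1_eq[of p k] p by simp
      finally show ?thesis by (simp add: algebra_simps)
    qed
    then have "real (k * (k - 1) * ((k - 2) choose (p - 2))) = real (p * (p - 1) * (k choose p))"
      by presburger
    ultimately show ?thesis using p k by (simp add: eq of_nat_diff)
  qed
qed

text \<open>
  The sum of \<open>\<zeta> * card (I \<inter> J)\<close> over all pairs equals \<open>(k choose p)\<^sup>2 * p\<^sup>2 * \<zeta> / k\<close> exactly, and it
  agrees with \<open>c I J\<close> unless \<open>card (I \<inter> J) \<ge> 2\<close>. The exceptional pairs are counted by the second
  factorial moment of \<open>card (I \<inter> J)\<close>.
\<close>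

lemma u_statistic_variance:
  fixes c :: "nat set \<Rightarrow> nat set \<Rightarrow> real"
  assumes p: "1 \<le> p" "p \<le> k" and k: "2 \<le> k" and D: "0 \<le> D"
  defines "F \<equiv> {I. I \<subseteq> {..<k} \<and> card I = p}"
  assumes disj: "\<And>I J. I \<in> F \<Longrightarrow> J \<in> F \<Longrightarrow> I \<inter> J = {} \<Longrightarrow> c I J = 0"
    and one: "\<And>I J i. I \<in> F \<Longrightarrow> J \<in> F \<Longrightarrow> I \<inter> J = {i} \<Longrightarrow> c I J = \<zeta>"
    and bound: "\<And>I J. I \<in> F \<Longrightarrow> J \<in> F \<Longrightarrow> \<bar>c I J\<bar> \<le> D"
  shows "\<bar>(\<Sum>I\<in>F. \<Sum>J\<in>F. c I J) / real (k choose p) ^ 2 - real p ^ 2 * \<zeta> / real k\<bar>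
           \<le> 2 * real p ^ 4 * (D + real p * \<bar>\<zeta>\<bar>) / real k ^ 2"
proof -
  define N where "N = real (k choose p)"
  have N: "N > 0" using p by (simp add: N_def)
  have fin: "finite F" unfolding F_def by (rule finite_subset[of _ "Pow {..<k}"]) auto
  define w where "w I J = real (card (I \<inter> J))" for I J :: "nat set"
  \<comment> \<open>The number of \<open>p\<close>-subsets through both \<open>i\<close> and
    \<open>j\<close>. Writing intersection sizes as sums of indicators and exchanging sums turns
    their moments over pairs \<open>I\<close>, \<open>J\<close> into sums of squares of these
    counts.\<close>
  define a where "a i j = (\<Sum>I\<in>F. of_bool (i \<in> I \<and> j \<in> I) :: real)" for i j
  have w: "w I J = (\<Sum>i<k. of_bool (i \<in> I) * of_bool (i \<in> J))" if "I \<in> F" for I J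
  proof -
    have "(\<Sum>i<k. of_bool (i \<in> I) * of_bool (i \<in> J)) = (\<Sum>i\<in>I \<inter> J. 1 :: real)"
      using that by (intro sum.mono_neutral_cong_right) (auto simp: F_def)
    then show ?thesis by (simp add: w_def)
  qed
  have aii: "a i i = p * N / k" if "i < k" for i
    using sum_indicator_supersets[OF that p(1)] k
    by (simp add: a_def F_def N_def field_simps)
  have aij: "a i j = p * (real p - 1) * N / (k * (real k - 1))" if "i < k" "j < k" "i \<noteq> j" for i j
    using sum_indicator_pair_supersets[OF that p(1)] k
    by (simp add: a_def F_def N_def field_simps)
  have sw: "(\<Sum>I\<in>F. \<Sum>J\<in>F. w I J) = (\<Sum>i<k. (a i i)\<^sup>2)"
  proof -
    have "(\<Sum>I\<in>F. \<Sum>J\<in>F. w I J) = (\<Sum>I\<in>F. \<Sum>J\<in>F. \<Sum>i<k. of_bool (i \<in> I) * of_bool (i \<in> J))"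
      by (intro sum.cong refl w)
    also have "\<dots> = (\<Sum>i<k. \<Sum>I\<in>F. \<Sum>J\<in>F. of_bool (i \<in> I) * of_bool (i \<in> J))"
      by (subst (2) sum.swap, subst sum.swap) rule
    also have "\<dots> = (\<Sum>i<k. (a i i)\<^sup>2)"
      by (simp add: a_def power2_eq_square sum_product)
    finally show ?thesis .
  qed
  have sw2: "(\<Sum>I\<in>F. \<Sum>J\<in>F. (w I J)\<^sup>2) = (\<Sum>i<k. \<Sum>j<k. (a i j)\<^sup>2)"
  proof -
    have "(\<Sum>I\<in>F. \<Sum>J\<in>F. (w I J)\<^sup>2)
        = (\<Sum>I\<in>F. \<Sum>J\<in>F. \<Sum>i<k. \<Sum>j<k. of_bool (i \<in> I \<and> j \<in> I) * of_bool (i \<in> J \<and> j \<in> J))"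
    proof (intro sum.cong refl)
      fix I J assume "I \<in> F"
      show "(w I J)\<^sup>2 = (\<Sum>i<k. \<Sum>j<k. of_bool (i \<in> I \<and> j \<in> I) * of_bool (i \<in> J \<and> j \<in> J))"
        unfolding w[OF \<open>I \<in> F\<close>] power2_eq_square sum_product
        by (simp only: of_bool_conj mult_ac)
    qed
    also have "\<dots> = (\<Sum>i<k. \<Sum>I\<in>F. \<Sum>J\<in>F. \<Sum>j<k. of_bool (i \<in> I \<and> j \<in> I) * of_bool (i \<in> J \<and> j \<in> J))"
      by (subst (2) sum.swap, subst sum.swap) rule
    also have "\<dots> = (\<Sum>i<k. \<Sum>j<k. \<Sum>I\<in>F. \<Sum>J\<in>F. of_bool (i \<in> I \<and> j \<in> I) * of_bool (i \<in> J \<and> j \<in> J))"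
      by (intro sum.cong refl) (subst (2) sum.swap, subst sum.swap, rule)
    also have "\<dots> = (\<Sum>i<k. \<Sum>j<k. (a i j)\<^sup>2)"
      by (simp add: a_def power2_eq_square sum_product)
    finally show ?thesis .
  qed
  have first: "(\<Sum>I\<in>F. \<Sum>J\<in>F. w I J) = (p * N)\<^sup>2 / k"
    using k by (simp add: sw aii power2_eq_square)
  \<comment> \<open>Subtracting the first moment removes exactly the diagonal \<open>i = j\<close>;
    the remaining \<open>k * (k - 1)\<close> summands are all equal.\<close>
  have second: "(\<Sum>I\<in>F. \<Sum>J\<in>F. (w I J)\<^sup>2 - w I J) = (p * (real p - 1) * N)\<^sup>2 / (k * (real k - 1))"
  proof -
    have "(\<Sum>I\<in>F. \<Sum>J\<in>F. (w I J)\<^sup>2 - w I J) = (\<Sum>i<k. (\<Sum>j<k. (a i j)\<^sup>2) - (a i i)\<^sup>2)"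
      by (simp add: sum_subtractf sw sw2)
    also have "\<dots> = (\<Sum>i<k. \<Sum>j\<in>{..<k} - {i}. (a i j)\<^sup>2)"
      by (intro sum.cong refl) (simp add: sum_diff1)
    also have "\<dots> = (\<Sum>i<k. \<Sum>j\<in>{..<k} - {i}. (p * (real p - 1) * N / (k * (real k - 1)))\<^sup>2)"
      by (intro sum.cong refl) (auto simp: aij)
    also have "\<dots> = k * (real k - 1) * (p * (real p - 1) * N / (k * (real k - 1)))\<^sup>2"
      using k by (simp add: of_nat_diff)
    also have "\<dots> = (p * (real p - 1) * N)\<^sup>2 / (k * (real k - 1))"
      using k by (simp add: power2_eq_square)
    finally show ?thesis .
  qed
  \<comment> \<open>With \<open>t = card (I \<inter> J)\<close>, the weight \<open>t^2 - t\<close>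
    vanishes for \<open>t = 0\<close> and \<open>t = 1\<close>, where the left side is zero, and is
    at least 1 from \<open>t = 2\<close> on, where the crude bound applies.\<close>
  have diff: "\<bar>c I J - \<zeta> * w I J\<bar> \<le> (D + p * \<bar>\<zeta>\<bar>) * ((w I J)\<^sup>2 - w I J)" if IJ: "I \<in> F" "J \<in> F" for I J
  proof -
    have finI: "finite (I \<inter> J)" using IJ by (auto simp: F_def intro: finite_subset)
    consider "card (I \<inter> J) = 0" | "card (I \<inter> J) = 1" | "card (I \<inter> J) \<ge> 2" by linarith
    then show ?thesis
    proof cases
      case 1
      then show ?thesis using disj[OF IJ] finI by (simp add: w_def)
    next
      case 2
      then show ?thesis using one[OF IJ] by (auto simp: w_def card_1_singleton_iff)
    next
      case 3
      have "card (I \<inter> J) \<le> card I" using IJ by (intro card_mono) (auto simp: F_def intro: finite_subset)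
      then have wp: "w I J \<le> p" using IJ by (simp add: w_def F_def)
      have w2: "w I J \<ge> 2" using 3 by (simp add: w_def)
      have "2 * 1 \<le> w I J * (w I J - 1)" using w2 by (intro mult_mono) auto
      then have w3: "1 \<le> (w I J)\<^sup>2 - w I J" by (simp add: power2_eq_square algebra_simps)
      have "\<bar>c I J - \<zeta> * w I J\<bar> \<le> \<bar>c I J\<bar> + \<bar>\<zeta>\<bar> * w I J"
        using abs_triangle_ineq4[of "c I J" "\<zeta> * w I J"] w2 by (simp add: abs_mult)
      also have "\<dots> \<le> D + \<bar>\<zeta>\<bar> * p"
        using bound[OF IJ] wp by (intro add_mono mult_left_mono) auto
      also have "\<dots> \<le> (D + p * \<bar>\<zeta>\<bar>) * ((w I J)\<^sup>2 - w I J)"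
        using mult_left_mono[OF w3, of "D + p * \<bar>\<zeta>\<bar>"] D by (simp add: mult.commute[of "real p"])
      finally show ?thesis .
    qed
  qed
  have "(\<Sum>I\<in>F. \<Sum>J\<in>F. c I J) / N\<^sup>2 - real p ^ 2 * \<zeta> / real k
      = (\<Sum>I\<in>F. \<Sum>J\<in>F. c I J - \<zeta> * w I J) / N\<^sup>2"
  proof -
    have "(\<Sum>I\<in>F. \<Sum>J\<in>F. c I J - \<zeta> * w I J)
        = (\<Sum>I\<in>F. \<Sum>J\<in>F. c I J) - \<zeta> * (\<Sum>I\<in>F. \<Sum>J\<in>F. w I J)"
      by (simp add: sum_subtractf sum_distrib_left)
    then show ?thesis
      using N k by (simp add: first diff_divide_distrib power_mult_distrib)
  qed
  also have "\<bar>\<dots>\<bar> = \<bar>\<Sum>I\<in>F. \<Sum>J\<in>F. c I J - \<zeta> * w I J\<bar> / N\<^sup>2"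
    by simp
  also have "\<dots> \<le> (\<Sum>I\<in>F. \<Sum>J\<in>F. (D + p * \<bar>\<zeta>\<bar>) * ((w I J)\<^sup>2 - w I J)) / N\<^sup>2"
    by (intro divide_right_mono order_trans[OF sum_abs] sum_mono order_trans[OF sum_abs] diff) auto
  also have "\<dots> = (D + p * \<bar>\<zeta>\<bar>) * ((p * (real p - 1))\<^sup>2 / (k * (real k - 1)))"
    using N by (simp only: sum_distrib_left[symmetric] second) (simp add: power_mult_distrib)
  also have "\<dots> \<le> (D + p * \<bar>\<zeta>\<bar>) * (2 * real p ^ 4 / real k ^ 2)"
  proof (intro mult_left_mono)
    have "(p * (real p - 1))\<^sup>2 \<le> (real p * real p)\<^sup>2"
      using p by (intro power_mono mult_mono) auto
    then have 1: "(p * (real p - 1))\<^sup>2 \<le> real p ^ 4" by (simp add: power2_eq_square power4_eq_xxxx mult.assoc)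
    \<comment> \<open>The inequality \<open>k \<le> 2 * (k - 1)\<close>, valid from
      \<open>k = 2\<close> on, is the source of the factor 2 in the final bound.\<close>
    have 2: "real k ^ 2 \<le> 2 * (k * (real k - 1))"
      using k mult_left_mono[of 2 "real k" "real k"] by (simp add: power2_eq_square algebra_simps)
    have "(p * (real p - 1))\<^sup>2 / (k * (real k - 1)) \<le> real p ^ 4 / (real k ^ 2 / 2)"
      using k 1 2 by (intro frac_le) auto
    then show "(p * (real p - 1))\<^sup>2 / (k * (real k - 1)) \<le> 2 * real p ^ 4 / real k ^ 2"
      by (simp add: mult.commute)
  qed (use D in auto)
  finally show ?thesis by (simp add: N_def mult_ac)
qed

section \<open>Traces of powers and singular values\<close>

lemma mat_trace_carrier: "B \<in> carrier_mat n n \<Longrightarrow> mat_trace B = (\<Sum>i<n. B $$ (i, i))"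
  by (auto simp: mat_trace_def)

lemma index_mult_mat_sum:
  assumes "A \<in> carrier_mat n m" "B \<in> carrier_mat m l" "i < n" "j < l"
  shows "(A * B) $$ (i, j) = (\<Sum>h<m. A $$ (i, h) * B $$ (h, j))"
  using assms by (auto simp: scalar_prod_def atLeast0LessThan intro!: sum.cong)

lemma mat_trace_mult_comm:
  assumes A: "A \<in> carrier_mat n m" and B: "B \<in> carrier_mat m n"
  shows "mat_trace (A * B) = mat_trace (B * A)"
proof -
  have "mat_trace (A * B) = (\<Sum>i<n. \<Sum>h<m. A $$ (i, h) * B $$ (h, i))"
    unfolding mat_trace_carrier[OF mult_carrier_mat[OF A B]]
    by (intro sum.cong refl index_mult_mat_sum[OF A B]) auto
  also have "\<dots> = (\<Sum>h<m. \<Sum>i<n. B $$ (h, i) * A $$ (i, h))"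
    by (subst sum.swap) (simp add: mult.commute)
  also have "\<dots> = mat_trace (B * A)"
    unfolding mat_trace_carrier[OF mult_carrier_mat[OF B A]]
    by (intro sum.cong refl index_mult_mat_sum[OF B A, symmetric]) auto
  finally show ?thesis .
qed

lemma upper_triangular_pow:
  fixes C :: "'a :: semiring_1 mat"
  assumes C: "C \<in> carrier_mat n n" "upper_triangular C"
  shows "upper_triangular (C ^\<^sub>m q) \<and> (\<forall>i<n. (C ^\<^sub>m q) $$ (i, i) = C $$ (i, i) ^ q)"
proof (induction q)
  case 0
  then show ?case using C by auto
next
  case (Suc q)
  let ?E = "C ^\<^sub>m q"
  have E: "?E \<in> carrier_mat n n" "\<And>i j. j < i \<Longrightarrow> i < n \<Longrightarrow> ?E $$ (i, j) = 0"
    "\<And>i. i < n \<Longrightarrow> ?E $$ (i, i) = C $$ (i, i) ^ q"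
    using Suc C by (auto elim: upper_triangularD)
  have C0: "\<And>i j. j < i \<Longrightarrow> i < n \<Longrightarrow> C $$ (i, j) = 0"
    using C by (auto elim: upper_triangularD)
  have ind: "(?E * C) $$ (i, j) = (\<Sum>h<n. ?E $$ (i, h) * C $$ (h, j))" if "i < n" "j < n" for i j
    using index_mult_mat_sum[OF E(1) C(1) that] .
  have "(?E * C) $$ (i, j) = 0" if "j < i" "i < n" for i j
  proof -
    have "?E $$ (i, h) * C $$ (h, j) = 0" if "h < n" for h
      using that \<open>j < i\<close> \<open>i < n\<close> E(2)[of h i] C0[of j h] by (cases "h < i") auto
    then show ?thesis using that by (simp add: ind)
  qed
  moreover have "(?E * C) $$ (i, i) = C $$ (i, i) ^ Suc q" if "i < n" for i
  proof -
    have "?E $$ (i, h) * C $$ (h, i) = (if h = i then C $$ (i, i) ^ Suc q else 0)" if "h < n" for h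
      using that \<open>i < n\<close> E(2)[of h i] E(3)[of i] C0[of i h]
      by (cases h i rule: linorder_cases) (auto simp: power_Suc2 simp del: power_Suc)
    then have "(\<Sum>h<n. ?E $$ (i, h) * C $$ (h, i)) = (\<Sum>h<n. if h = i then C $$ (i, i) ^ Suc q else 0)"
      by (intro sum.cong) auto
    then show ?thesis using that by (simp add: ind)
  qed
  ultimately show ?case using E C by (auto intro!: upper_triangularI)
qed

text \<open>Splitting of the characteristic polynomial is all that Schur triangularisation asks for.
  The same pair \<open>P\<close>, \<open>Q\<close> conjugates every power, cyclicity of the trace
  cancels it, and a power of a triangular matrix has the powers of the diagonal on its
  diagonal.\<close>

lemma mat_trace_pow_char_poly_roots:
  fixes B :: "real mat"
  assumes B: "B \<in> carrier_mat n n" and cp: "char_poly B = (\<Prod>e\<leftarrow>es. [:- e, 1:])"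
  shows "mat_trace (B ^\<^sub>m q) = (\<Sum>e\<leftarrow>es. e ^ q)"
proof -
  obtain C P Q where schur: "schur_decomposition B es = (C, P, Q)"
    using prod_cases3 by blast
  have wit: "similar_mat_wit B C P Q" and ut: "upper_triangular C" and diag: "diag_mat C = es"
    using schur_decomposition[OF B cp schur] by auto
  note w = similar_mat_witD2[OF B wit]
  have C: "C \<in> carrier_mat n n" using w by simp
  have "mat_trace (B ^\<^sub>m q) = mat_trace (P * (C ^\<^sub>m q * Q))"
    unfolding similar_mat_wit_pow_id[OF wit]
    using w(4-7) by (simp add: assoc_mult_mat[of _ n n _ n _ n])
  also have "\<dots> = mat_trace (C ^\<^sub>m q * Q * P)"
    using w(4-7) by (intro mat_trace_mult_comm) auto
  also have "C ^\<^sub>m q * Q * P = C ^\<^sub>m q"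
    using w(2,4-7) by (simp add: assoc_mult_mat[of _ n n _ n _ n])
  also have "mat_trace (C ^\<^sub>m q) = (\<Sum>i<n. C $$ (i, i) ^ q)"
    using upper_triangular_pow[OF C ut] C by (subst mat_trace_carrier[of _ n]) auto
  also have "\<dots> = (\<Sum>e\<leftarrow>es. e ^ q)"
    using C by (simp add: diag[symmetric] diag_mat_def comp_def interv_sum_list_conv_sum_set_nat atLeast0LessThan)
  finally show ?thesis .
qed

section \<open>Symmetric and Gram matrices: real and nonnegative spectra\<close>

lemma symmetric_mat_complex_eigenvalue_real:
  fixes B :: "real mat"
  assumes B: "B \<in> carrier_mat n n" and sym: "transpose_mat B = B"
    and ev: "eigenvalue (map_mat complex_of_real B) z"
  shows "z \<in> \<real>"
proof -
  obtain v where v: "v \<in> carrier_vec n" "v \<noteq> 0\<^sub>v n"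
      and eq: "map_mat complex_of_real B *\<^sub>v v = z \<cdot>\<^sub>v v"
    using ev B by (auto simp: eigenvalue_def eigenvector_def)
  have sym': "B $$ (j, i) = B $$ (i, j)" if "i < n" "j < n" for i j
    using that B arg_cong[OF sym, of "\<lambda>M. M $$ (i, j)"] by auto
  have row: "(\<Sum>j<n. of_real (B $$ (i, j)) * vec_index v j) = z * vec_index v i" if "i < n" for i
    using that B v arg_cong[OF eq, of "\<lambda>u. vec_index u i"]
    by (simp add: scalar_prod_def atLeast0LessThan)
  \<comment> \<open>The Hermitian form of \<open>B\<close> at the eigenvector \<open>v\<close>. It
    equals \<open>z\<close> times the squared norm of \<open>v\<close>, and it is its own conjugate
    because \<open>B\<close> is real and symmetric; so \<open>z\<close> is real.\<close>
  define s where "s = (\<Sum>i<n. cnj (vec_index v i) * (\<Sum>j<n. of_real (B $$ (i, j)) * vec_index v j))"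
  define N where "N = (\<Sum>i<n. (cmod (vec_index v i))\<^sup>2)"
  have s1: "s = z * of_real N"
  proof -
    have "s = (\<Sum>i<n. z * of_real ((cmod (vec_index v i))\<^sup>2))"
      unfolding s_def
      by (intro sum.cong refl) (simp only: lessThan_iff row complex_norm_square, simp only: mult_ac)
    then show ?thesis by (simp add: N_def sum_distrib_left)
  qed
  have s2: "cnj s = s"
  proof -
    have "cnj s = (\<Sum>i<n. \<Sum>j<n. vec_index v i * of_real (B $$ (i, j)) * cnj (vec_index v j))"
      by (simp add: s_def sum_distrib_left mult_ac)
    also have "\<dots> = (\<Sum>j<n. \<Sum>i<n. vec_index v i * of_real (B $$ (i, j)) * cnj (vec_index v j))"
      by (rule sum.swap)
    also have "\<dots> = s"
      unfolding s_def sum_distrib_left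
      by (intro sum.cong refl) (simp add: sym' mult_ac)
    finally show ?thesis .
  qed
  obtain i where i: "i < n" "vec_index v i \<noteq> 0"
    using v by (metis carrier_vecD eq_vecI index_zero_vec)
  have "N > 0"
    unfolding N_def using i by (intro sum_pos2[of _ i]) auto
  then have "cnj z = z" using s1 s2 by auto
  then show ?thesis by (simp add: Reals_cnj_iff)
qed

text \<open>The polynomial factors over the complex numbers and all its roots are real, so the
  factorisation is the image of a real one; the embedding of real into complex polynomials is
  injective.\<close>

lemma symmetric_mat_char_poly_splits:
  fixes B :: "real mat"
  assumes B: "B \<in> carrier_mat n n" and sym: "transpose_mat B = B"
  obtains es where "char_poly B = (\<Prod>e\<leftarrow>es. [:- e, 1:])"
proof -
  let ?c = complex_of_real
  interpret pc: map_poly_inj_comm_ring_hom ?c ..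
  have cB: "map_mat ?c B \<in> carrier_mat n n" using B by simp
  obtain zs where zs: "char_poly (map_mat ?c B) = (\<Prod>z\<leftarrow>zs. [:- z, 1:])"
    using char_poly_factorized[OF cB] by auto
  have real: "of_real (Re z) = z" if "z \<in> set zs" for z
  proof -
    have "poly (char_poly (map_mat ?c B)) z = 0"
      using that by (auto simp: zs poly_prod_list prod_list_zero_iff)
    then have "eigenvalue (map_mat ?c B) z"
      using eigenvalue_root_char_poly[OF cB] by simp
    then show ?thesis
      using symmetric_mat_complex_eigenvalue_real[OF B sym] by auto
  qed
  have "map_poly ?c (char_poly B) = (\<Prod>z\<leftarrow>zs. [:- z, 1:])"
    unfolding zs[symmetric] by (rule of_real_hom.char_poly_hom[OF B, symmetric])
  also have "\<dots> = (\<Prod>z\<leftarrow>zs. map_poly ?c [:- Re z, 1:])"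
    by (intro arg_cong[of _ _ prod_list] map_cong refl) (simp add: real)
  also have "\<dots> = map_poly ?c (\<Prod>e\<leftarrow>map Re zs. [:- e, 1:])"
    by (simp add: pc.hom_prod_list comp_def)
  finally have "char_poly B = (\<Prod>e\<leftarrow>map Re zs. [:- e, 1:])"
    by simp
  then show ?thesis by (rule that)
qed

lemma proots_prod_linear_factors: "proots (\<Prod>e\<leftarrow>es. [:- e, 1:]) = (mset es :: 'a :: idom multiset)"
proof (induction es)
  case (Cons a es)
  have "(\<Prod>e\<leftarrow>es. [:- e, 1:]) \<noteq> 0" by (auto simp: prod_list_zero_iff)
  then have "proots ([:- a, 1:] * (\<Prod>e\<leftarrow>es. [:- e, 1:])) = proots [:- a, 1:] + proots (\<Prod>e\<leftarrow>es. [:- e, 1:])"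
    by (intro proots_mult) auto
  then show ?case using Cons by (simp del: mult_pCons_left)
qed simp

text \<open>Pairing the eigenvalue equation with \<open>v\<close> gives
  \<open>e * (v \<bullet> v)\<close> as the squared norm of \<open>G v\<close>. The sign matters for
  taking square roots: \<open>sqrt\<close> is odd on the reals, so \<open>(sqrt e)^2\<close> is the
  absolute value of \<open>e\<close>.\<close>

lemma gram_eigenvalue_nonneg:
  fixes G :: "real mat"
  assumes G: "G \<in> carrier_mat m n" and ev: "eigenvalue (transpose_mat G * G) e"
  shows "e \<ge> 0"
proof -
  obtain v where v: "v \<in> carrier_vec n" "v \<noteq> 0\<^sub>v n"
      and eq: "(transpose_mat G * G) *\<^sub>v v = e \<cdot>\<^sub>v v"
    using ev G by (auto simp: eigenvalue_def eigenvector_def)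
  obtain i where i: "i < n" "vec_index v i \<noteq> 0"
    using v by (metis carrier_vecD eq_vecI index_zero_vec)
  have "transpose_mat G *\<^sub>v (G *\<^sub>v v) = e \<cdot>\<^sub>v v"
    unfolding eq[symmetric] using v G by (intro assoc_mult_mat_vec[symmetric, of _ n m]) auto
  then have "e * (v \<bullet> v) = v \<bullet> (transpose_mat G *\<^sub>v (G *\<^sub>v v))"
    using v by simp
  also have "\<dots> = (G *\<^sub>v v) \<bullet> (G *\<^sub>v v)"
    using v G transpose_vec_mult_scalar[of G m n v "G *\<^sub>v v"]
    by (simp add: comm_scalar_prod[of _ n])
  also have "\<dots> \<ge> 0" by (auto simp: scalar_prod_def intro!: sum_nonneg)
  finally have 1: "0 \<le> e * (v \<bullet> v)" .
  have "v \<bullet> v > 0"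
    using v i unfolding scalar_prod_def
    by (intro sum_pos2[of _ i]) (auto simp: zero_less_mult_iff neq_iff)
  then show ?thesis using 1 by (simp add: zero_le_mult_iff)
qed

text \<open>Both sides are the alternating word \<open>B A B ... A B\<close>. With the identity in
  place of \<open>A\<close> it also lets a matrix power be unrolled from the left.\<close>

lemma pow_mat_mult_intertwine:
  fixes A :: "real mat"
  assumes A: "A \<in> carrier_mat m n" and B: "B \<in> carrier_mat n m"
  shows "(B * A) ^\<^sub>m q * B = B * (A * B) ^\<^sub>m q"
proof (induction q)
  case 0
  then show ?case using A B by simp
next
  case (Suc q)
  have BA: "(B * A) ^\<^sub>m q \<in> carrier_mat n n" "(A * B) ^\<^sub>m q \<in> carrier_mat m m"
    using A B by (meson mult_carrier_mat pow_carrier_mat)+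
  have "(B * A) ^\<^sub>m Suc q * B = (B * A) ^\<^sub>m q * (B * A * B)"
    using A B BA by (simp add: assoc_mult_mat[of _ n n _ n _ m])
  also have "B * A * B = B * (A * B)" using A B by (simp add: assoc_mult_mat[of _ n m _ n _ m])
  also have "(B * A) ^\<^sub>m q * (B * (A * B)) = (B * A) ^\<^sub>m q * B * (A * B)"
    using A B BA by (simp add: assoc_mult_mat[of _ n n _ m _ m])
  also have "\<dots> = B * (A * B) ^\<^sub>m Suc q"
    unfolding Suc using A B BA by (simp add: assoc_mult_mat[of _ n m _ m _ m])
  finally show ?case .
qed

text \<open>Allows \<open>S = A * A^T\<close> to be used throughout, whichever Gram matrix is the
  smaller one. At \<open>q = 0\<close> the two traces would be the dimensions \<open>n\<close> and
  \<open>m\<close>.\<close>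

lemma mat_trace_pow_mult_comm:
  fixes A :: "real mat"
  assumes A: "A \<in> carrier_mat m n" and B: "B \<in> carrier_mat n m" and q: "q \<ge> 1"
  shows "mat_trace ((B * A) ^\<^sub>m q) = mat_trace ((A * B) ^\<^sub>m q)"
proof -
  obtain r where r: "q = Suc r" using q by (cases q) auto
  have BA: "(B * A) ^\<^sub>m r \<in> carrier_mat n n" "(A * B) ^\<^sub>m r \<in> carrier_mat m m"
    using A B by (meson mult_carrier_mat pow_carrier_mat)+
  have "mat_trace ((B * A) ^\<^sub>m q) = mat_trace ((B * A) ^\<^sub>m r * B * A)"
    using A B BA by (simp add: r assoc_mult_mat[of _ n n _ m _ n])
  also have "\<dots> = mat_trace (B * (A * B) ^\<^sub>m r * A)"
    by (simp add: pow_mat_mult_intertwine[OF A B])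
  also have "\<dots> = mat_trace (B * ((A * B) ^\<^sub>m r * A))"
    using A B BA by (simp add: assoc_mult_mat[of _ n m _ m _ n])
  also have "\<dots> = mat_trace ((A * B) ^\<^sub>m r * A * B)"
    using A B BA by (intro mat_trace_mult_comm[of _ n m]) auto
  also have "\<dots> = mat_trace ((A * B) ^\<^sub>m q)"
    using A B BA by (simp add: r assoc_mult_mat[of _ m m _ n _ m])
  finally show ?thesis .
qed

lemma gram_singular_values:
  fixes G :: "real mat"
  assumes G: "G \<in> carrier_mat m n"
  shows "(\<Sum>\<sigma>\<in>#image_mset sqrt (proots (char_poly (transpose_mat G * G))). \<sigma> ^ (2 * q))
           = mat_trace ((transpose_mat G * G) ^\<^sub>m q)"
proof -
  let ?B = "transpose_mat G * G"
  have B: "?B \<in> carrier_mat n n" using G by simp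
  have sym: "transpose_mat ?B = ?B"
    using G by (simp add: transpose_mult[of _ n m])
  obtain es where es: "char_poly ?B = (\<Prod>e\<leftarrow>es. [:- e, 1:])"
    using symmetric_mat_char_poly_splits[OF B sym] .
  have nonneg: "e \<ge> 0" if "e \<in> set es" for e
  proof -
    have "poly (char_poly ?B) e = 0"
      using that by (auto simp: es poly_prod_list prod_list_zero_iff)
    then show ?thesis
      using eigenvalue_root_char_poly[OF B] gram_eigenvalue_nonneg[OF G] by simp
  qed
  have "(\<Sum>\<sigma>\<in>#image_mset sqrt (proots (char_poly ?B)). \<sigma> ^ (2 * q)) = (\<Sum>e\<leftarrow>es. sqrt e ^ (2 * q))"
    unfolding es proots_prod_linear_factors
    by (simp add: mset_map[symmetric] sum_mset_sum_list comp_def del: mset_map)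
  also have "\<dots> = (\<Sum>e\<leftarrow>es. e ^ q)"
    by (intro arg_cong[of _ _ sum_list] map_cong refl) (simp add: power_mult nonneg)
  also have "\<dots> = mat_trace (?B ^\<^sub>m q)"
    using mat_trace_pow_char_poly_roots[OF B es] by simp
  finally show ?thesis .
qed

text \<open>The case split follows the choice of Gram matrix in \<open>singular_values\<close>:
  \<open>A^T * A\<close> has to be exchanged for \<open>A * A^T\<close>, while in the other case
  \<open>G = A^T\<close> gives \<open>A * A^T\<close> directly.\<close>

lemma sum_singular_values_pow:
  assumes A: "A \<in> carrier_mat m n" and q: "q \<ge> 1"
  shows "(\<Sum>\<sigma>\<in>#singular_values A. \<sigma> ^ (2 * q)) = mat_trace ((A * transpose_mat A) ^\<^sub>m q)"
proof (cases "n \<le> m")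
  case True
  then show ?thesis
    using A gram_singular_values[OF A] mat_trace_pow_mult_comm[OF A _ q, of "transpose_mat A"]
    by (simp add: singular_values_def)
next
  case False
  then show ?thesis
    using A gram_singular_values[of "transpose_mat A" n m]
    by (simp add: singular_values_def)
qed

lemma schatten_norm_pow:
  assumes A: "A \<in> carrier_mat m n" and q: "q \<ge> 1"
  shows "schatten_norm (2 * q) A ^ (2 * q) = mat_trace ((A * transpose_mat A) ^\<^sub>m q)"
proof -
  \<comment> \<open>Even powers make the sum nonnegative, and on nonnegative numbers the even root
    is undone by the power.\<close>
  have "(\<Sum>\<sigma>\<in>#N. \<sigma> ^ (2 * q)) \<ge> 0" for N :: "real multiset"
    by (induction N) (auto intro: add_nonneg_nonneg)
  then have "mat_trace ((A * transpose_mat A) ^\<^sub>m q) \<ge> 0"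
    by (metis sum_singular_values_pow[OF A q])
  then show ?thesis
    using q real_root_pow_pos2[of "2 * q" "mat_trace ((A * transpose_mat A) ^\<^sub>m q)"]
    by (simp add: schatten_norm_def sum_singular_values_pow[OF A q])
qed

section \<open>Expansion of the estimator\<close>

text \<open>The pair \<open>(h, J)\<close> corresponds to \<open>I = J \<union> {h}\<close> with
  \<open>h\<close> as its maximum. This converts a recursion on the last index of an increasing path
  into a sum over index sets.\<close>

lemma sum_subsets_Max:
  fixes f :: "nat \<Rightarrow> nat set \<Rightarrow> 'a :: comm_monoid_add"
  shows "(\<Sum>h<n. \<Sum>J | J \<subseteq> {..<h} \<and> card J = q. f h J)
       = (\<Sum>I | I \<subseteq> {..<n} \<and> card I = Suc q. f (Max I) (I - {Max I}))"
proof -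
  have fin: "finite {J. J \<subseteq> {..<h} \<and> card J = q}" for h :: nat
    by (rule finite_subset[of _ "Pow {..<h}"]) auto
  have Max_insert: "Max (insert h J) = h" if "J \<subseteq> {..<h}" for h and J :: "nat set"
    using that by (intro Max_eqI) (auto intro: finite_subset less_imp_le)
  have "(\<Sum>h<n. \<Sum>J | J \<subseteq> {..<h} \<and> card J = q. f h J)
      = (\<Sum>(h, J)\<in>(SIGMA h:{..<n}. {J. J \<subseteq> {..<h} \<and> card J = q}). f h J)"
    by (intro sum.Sigma) (auto simp: fin)
  also have "\<dots> = (\<Sum>I | I \<subseteq> {..<n} \<and> card I = Suc q. f (Max I) (I - {Max I}))"
  proof (rule sum.reindex_bij_witness[where i = "\<lambda>I. (Max I, I - {Max I})"
        and j = "\<lambda>(h, J). insert h J"], goal_cases)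
    case (1 x)
    then show ?case by (auto simp: Max_insert)
  next
    case (2 x)
    moreover obtain h J where "x = (h, J)" by fastforce
    moreover have "finite J" "h \<notin> J" if "J \<subseteq> {..<h}" for h and J :: "nat set"
      using that finite_subset by auto
    ultimately show ?case by (auto simp: Max_insert)
  next
    case (3 I)
    then have "finite I" "I \<noteq> {}" by (auto intro: finite_subset)
    then show ?case by (auto simp: insert_absorb)
  next
    case (4 I)
    then have I: "finite I" "I \<noteq> {}" by (auto intro: finite_subset)
    then have "Max I \<in> I" by simp
    moreover have "h < Max I" if "h \<in> I" "h \<noteq> Max I" for h
      using that I by (meson Max_ge le_neq_implies_less)
    ultimately show ?case using 4 I by auto
  next
    case (5 x)
    moreover have "J - {h} = J" if "J \<subseteq> {..<h}" for h and J :: "nat set"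
      using that by auto
    ultimately show ?case by (auto simp: Max_insert)
  qed
  finally show ?thesis .
qed

lemma sorted_list_of_set_insert_Max:
  assumes "J \<subseteq> {..<h :: nat}"
  shows "sorted_list_of_set (insert h J) = sorted_list_of_set J @ [h]"
proof -
  have fin: "finite J" using assms finite_subset by blast
  have "sorted_wrt (<) (sorted_list_of_set J @ [h])"
    using assms fin by (auto simp: sorted_wrt_append)
  moreover have "set (sorted_list_of_set J @ [h]) = insert h J" using fin by simp
  ultimately show ?thesis
    using fin by (intro strict_sorted_equal) (simp_all del: sorted_list_of_set_insert_remove)
qed

lemma sorted_list_of_set_Max:
  fixes I :: "nat set"
  assumes "finite I" "I \<noteq> {}"
  shows "sorted_list_of_set I = sorted_list_of_set (I - {Max I}) @ [Max I]"
proof -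
  have "I - {Max I} \<subseteq> {..<Max I}"
    using assms by (auto simp: less_le)
  then have "sorted_list_of_set (insert (Max I) (I - {Max I})) = sorted_list_of_set (I - {Max I}) @ [Max I]"
    by (rule sorted_list_of_set_insert_Max)
  moreover have "insert (Max I) (I - {Max I}) = I" using assms by (auto simp: insert_absorb)
  ultimately show ?thesis by simp
qed

fun path_weight :: "(nat \<Rightarrow> nat \<Rightarrow> real) \<Rightarrow> nat list \<Rightarrow> real" where
  "path_weight z (i # j # l) = z i j * path_weight z (j # l)"
| "path_weight z l = 1"

text \<open>On a single vertex the path product is empty and only the loop \<open>z i i\<close>
  remains, as required for \<open>p = 1\<close>, where the estimator is the trace of
  \<open>Z\<close> divided by \<open>k\<close>.\<close>

definition cycle_weight :: "(nat \<Rightarrow> nat \<Rightarrow> real) \<Rightarrow> nat list \<Rightarrow> real" where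
  "cycle_weight z l = path_weight z l * z (last l) (hd l)"

lemma path_weight_snoc: "l \<noteq> [] \<Longrightarrow> path_weight z (l @ [b]) = path_weight z l * z (last l) b"
  by (induction z l rule: path_weight.induct) auto

text \<open>An entry of the \<open>q\<close>-th power sums over paths of \<open>q\<close> steps, and
  strict triangularity forces them to increase, so a path ending in \<open>b\<close> is determined
  by the set \<open>J\<close> of its earlier vertices. The start vertex varies with \<open>J\<close>
  (it is \<open>b\<close> itself for \<open>q = 0\<close>); the free weight \<open>g\<close> on it
  is later set to the edge \<open>Z $$ (b, a)\<close> that closes the cycle.\<close>

lemma row_strict_upper_pow:
  assumes Z: "Z \<in> carrier_mat k k" and b: "b < k"
  shows "(\<Sum>a<k. g a * (strict_upper_part Z ^\<^sub>m q) $$ (a, b))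
       = (\<Sum>J | J \<subseteq> {..<b} \<and> card J = q.
            g (hd (sorted_list_of_set J @ [b]))
            * path_weight (\<lambda>i j. Z $$ (i, j)) (sorted_list_of_set J @ [b]))"
  using b
proof (induction q arbitrary: b)
  case 0
  have "{J. J \<subseteq> {..<b} \<and> card J = 0} = {{}}"
    using finite_subset[of _ "{..<b}"] by auto
  moreover have "(\<Sum>a<k. g a * (strict_upper_part Z ^\<^sub>m 0) $$ (a, b)) = (\<Sum>a<k. if a = b then g b else 0)"
    using 0 Z by (intro sum.cong) (auto simp: strict_upper_part_def)
  ultimately show ?case using 0 by simp
next
  case (Suc q)
  let ?T = "strict_upper_part Z" and ?z = "\<lambda>i j. Z $$ (i, j)"
  have T: "?T \<in> carrier_mat k k" using Z by (simp add: strict_upper_part_def)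
  then have Tq: "?T ^\<^sub>m q \<in> carrier_mat k k" by simp
  define W where "W l = g (hd l) * path_weight ?z l" for l
  have W_snoc: "W ((l @ [h]) @ [b]) = W (l @ [h]) * ?z h b" for l h
    unfolding W_def by (subst path_weight_snoc) (auto simp: hd_append)
  have "(\<Sum>a<k. g a * (?T ^\<^sub>m Suc q) $$ (a, b)) = (\<Sum>a<k. \<Sum>h<k. g a * (?T ^\<^sub>m q) $$ (a, h) * ?T $$ (h, b))"
    using index_mult_mat_sum[OF Tq T _ Suc.prems]
    by (simp add: sum_distrib_left mult.assoc)
  also have "\<dots> = (\<Sum>h<k. (\<Sum>a<k. g a * (?T ^\<^sub>m q) $$ (a, h)) * ?T $$ (h, b))"
    by (subst sum.swap) (simp add: sum_distrib_right)
  \<comment> \<open>Column \<open>b\<close> of the strict upper part vanishes from row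
    \<open>b\<close> on, which confines the previous vertex to \<open>h < b\<close>.\<close>
  also have "\<dots> = (\<Sum>h<b. (\<Sum>a<k. g a * (?T ^\<^sub>m q) $$ (a, h)) * ?z h b)"
    using Suc.prems Z by (intro sum.mono_neutral_cong_right) (auto simp: strict_upper_part_def)
  also have "\<dots> = (\<Sum>h<b. \<Sum>J | J \<subseteq> {..<h} \<and> card J = q. W ((sorted_list_of_set J @ [h]) @ [b]))"
    using Suc.prems by (intro sum.cong refl) (simp only: W_snoc, simp add: Suc.IH W_def sum_distrib_right)
  also have "\<dots> = (\<Sum>I | I \<subseteq> {..<b} \<and> card I = Suc q. W ((sorted_list_of_set (I - {Max I}) @ [Max I]) @ [b]))"
    by (rule sum_subsets_Max)
  also have "\<dots> = (\<Sum>I | I \<subseteq> {..<b} \<and> card I = Suc q. W (sorted_list_of_set I @ [b]))"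
    by (intro sum.cong refl, subst sorted_list_of_set_Max[symmetric]) (auto intro: finite_subset)
  finally show ?case by (simp add: W_def)
qed

lemma mat_trace_strict_upper_pow_mult:
  assumes Z: "Z \<in> carrier_mat k k"
  shows "mat_trace (strict_upper_part Z ^\<^sub>m q * Z)
       = (\<Sum>I | I \<subseteq> {..<k} \<and> card I = Suc q. cycle_weight (\<lambda>i j. Z $$ (i, j)) (sorted_list_of_set I))"
proof -
  let ?T = "strict_upper_part Z" and ?z = "\<lambda>i j. Z $$ (i, j)"
  have "?T \<in> carrier_mat k k" using Z by (simp add: strict_upper_part_def)
  then have Tq: "?T ^\<^sub>m q \<in> carrier_mat k k" by simp
  define f where "f b J = cycle_weight ?z (sorted_list_of_set J @ [b])" for b J
  have "mat_trace (?T ^\<^sub>m q * Z) = (\<Sum>a<k. \<Sum>b<k. (?T ^\<^sub>m q) $$ (a, b) * Z $$ (b, a))"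
    unfolding mat_trace_carrier[OF mult_carrier_mat[OF Tq Z]]
    by (intro sum.cong refl index_mult_mat_sum[OF Tq Z]) auto
  also have "\<dots> = (\<Sum>b<k. \<Sum>a<k. Z $$ (b, a) * (?T ^\<^sub>m q) $$ (a, b))"
    by (subst sum.swap) (simp add: mult.commute)
  also have "\<dots> = (\<Sum>b<k. \<Sum>J | J \<subseteq> {..<b} \<and> card J = q. f b J)"
    by (intro sum.cong refl) (simp add: row_strict_upper_pow[OF Z] f_def cycle_weight_def mult.commute)
  also have "\<dots> = (\<Sum>I | I \<subseteq> {..<k} \<and> card I = Suc q. f (Max I) (I - {Max I}))"
    by (rule sum_subsets_Max)
  also have "\<dots> = (\<Sum>I | I \<subseteq> {..<k} \<and> card I = Suc q. cycle_weight ?z (sorted_list_of_set I))"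
    unfolding f_def
    by (intro sum.cong refl, subst sorted_list_of_set_Max[symmetric]) (auto intro: finite_subset)
  finally show ?thesis .
qed

section \<open>Products of rank-one matrices and cycles in the Gram matrix\<close>

definition outer_mat :: "nat \<Rightarrow> (nat \<Rightarrow> nat \<Rightarrow> real) \<Rightarrow> nat \<Rightarrow> real mat" where
  "outer_mat m y i = mat m m (\<lambda>(a, b). y i a * y i b)"

text \<open>A Gram entry mixes two columns, whereas each factor of this product involves one. Over
  distinct indices the factors are therefore independent, which is why the estimator is rewritten in
  terms of it.\<close>

definition outer_prod :: "nat \<Rightarrow> (nat \<Rightarrow> nat \<Rightarrow> real) \<Rightarrow> nat list \<Rightarrow> real mat" where
  "outer_prod m y l = foldr (\<lambda>i P. outer_mat m y i * P) l (1\<^sub>m m)"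

definition gram :: "nat \<Rightarrow> (nat \<Rightarrow> nat \<Rightarrow> real) \<Rightarrow> nat \<Rightarrow> nat \<Rightarrow> real" where
  "gram m y i j = (\<Sum>a<m. y i a * y j a)"

lemma outer_mat_carrier [simp]: "outer_mat m y i \<in> carrier_mat m m"
  by (simp add: outer_mat_def)

lemma outer_prod_simps [simp]:
  "outer_prod m y [] = 1\<^sub>m m" "outer_prod m y (i # l) = outer_mat m y i * outer_prod m y l"
  by (simp_all add: outer_prod_def)

lemma outer_prod_carrier [simp]: "outer_prod m y l \<in> carrier_mat m m"
  by (induction l) (auto intro!: mult_carrier_mat[OF outer_mat_carrier])

lemma outer_prod_append: "outer_prod m y (xs @ ys) = outer_prod m y xs * outer_prod m y ys"
proof (induction xs)
  case (Cons i xs)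
  then show ?case
    using assoc_mult_mat[of "outer_mat m y i" m m "outer_prod m y xs" m "outer_prod m y ys" m] by simp
qed (simp add: left_mult_one_mat[OF outer_prod_carrier])

text \<open>Neighbouring rank-one factors meet in an inner product: only the first vector, the last
  vector and the Gram entries along the path survive.\<close>

lemma outer_prod_index:
  assumes "l \<noteq> []" "a < m" "b < m"
  shows "outer_prod m y l $$ (a, b) = y (hd l) a * path_weight (gram m y) l * y (last l) b"
  using assms
proof (induction l arbitrary: a)
  case (Cons i l)
  have step: "outer_prod m y (i # l) $$ (a, b) = (\<Sum>c<m. y i a * y i c * outer_prod m y l $$ (c, b))"
    using Cons.prems index_mult_mat_sum[OF outer_mat_carrier outer_prod_carrier, of a m b y i y l]
    by (simp add: outer_mat_def)
  show ?case
  proof (cases l)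
    case Nil
    have "outer_prod m y (i # l) $$ (a, b) = (\<Sum>c<m. if c = b then y i a * y i b else 0)"
      unfolding step using Cons.prems by (intro sum.cong) (auto simp: Nil)
    then show ?thesis using Cons.prems by (simp add: Nil)
  next
    case (Cons j l')
    have "outer_prod m y (i # l) $$ (a, b)
        = (\<Sum>c<m. y i a * y i c * (y j c * path_weight (gram m y) l * y (last l) b))"
      unfolding step using Cons.prems
      by (intro sum.cong refl, subst Cons.IH) (simp_all add: Cons del: outer_prod_simps)
    also have "\<dots> = y i a * gram m y i j * path_weight (gram m y) l * y (last l) b"
      by (simp add: gram_def sum_distrib_left sum_distrib_right mult_ac)
    finally show ?thesis by (simp add: Cons)
  qed
qed simp

lemma cycle_weight_gram:
  assumes "l \<noteq> []"
  shows "cycle_weight (gram m y) l = mat_trace (outer_prod m y l)"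
proof -
  have "mat_trace (outer_prod m y l) = (\<Sum>a<m. y (hd l) a * path_weight (gram m y) l * y (last l) a)"
    by (simp add: mat_trace_carrier[OF outer_prod_carrier] outer_prod_index[OF assms])
  then show ?thesis
    by (simp add: cycle_weight_def gram_def sum_distrib_left mult_ac)
qed

text \<open>Exposes one chosen column: the trace becomes a quadratic form in \<open>y i\<close>
  whose coefficients come from the other factors in cyclic order, \<open>ys\<close> before
  \<open>xs\<close>.\<close>

lemma mat_trace_outer_prod_rotate:
  "mat_trace (outer_prod m y (xs @ i # ys))
     = (\<Sum>a<m. \<Sum>b<m. y i a * y i b * outer_prod m y (ys @ xs) $$ (b, a))"
proof -
  have "mat_trace (outer_prod m y (xs @ i # ys)) = mat_trace (outer_prod m y ((i # ys) @ xs))"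
    unfolding outer_prod_append by (rule mat_trace_mult_comm[of _ m m]) (simp_all del: outer_prod_simps)
  also have "outer_prod m y ((i # ys) @ xs) = outer_mat m y i * outer_prod m y (ys @ xs)"
    by simp
  also have "mat_trace \<dots> = (\<Sum>a<m. \<Sum>b<m. outer_mat m y i $$ (a, b) * outer_prod m y (ys @ xs) $$ (b, a))"
    unfolding mat_trace_carrier[OF mult_carrier_mat[OF outer_mat_carrier outer_prod_carrier]]
    by (intro sum.cong refl index_mult_mat_sum[of _ m m _ m]) auto
  finally show ?thesis by (simp add: outer_mat_def)
qed

lemma gram_square_le: "(gram m y i j)\<^sup>2 \<le> gram m y i i * gram m y j j"
  using Cauchy_Schwarz_ineq_sum[of "y i" "y j" "{..<m}"] by (simp add: gram_def power2_eq_square)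

lemma gram_self_nonneg: "gram m y i i \<ge> 0"
  by (simp add: gram_def sum_nonneg)

text \<open>Each squared edge is at most the product of the squared norms of its ends. Inner
  vertices lie on two edges and end vertices on one, so one further squared norm at each end makes
  all vertices contribute equally. These two extra factors are what the closing edge of a cycle
  supplies.\<close>

lemma path_weight_gram_square_le:
  assumes "l \<noteq> []"
  shows "(path_weight (gram m y) l)\<^sup>2 * gram m y (hd l) (hd l) * gram m y (last l) (last l)
           \<le> (\<Prod>i\<leftarrow>l. (gram m y i i)\<^sup>2)"
  using assms
proof (induction "gram m y" l rule: path_weight.induct)
  case (1 i j l)
  let ?g = "gram m y" and ?w = "path_weight (gram m y) (j # l)"
  have "(?w)\<^sup>2 * (?g i j)\<^sup>2 * ?g i i * ?g (last (j # l)) (last (j # l))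
      \<le> (?w)\<^sup>2 * (?g i i * ?g j j) * ?g i i * ?g (last (j # l)) (last (j # l))"
    by (intro mult_right_mono mult_left_mono gram_square_le gram_self_nonneg) auto
  also have "\<dots> = (?g i i)\<^sup>2 * ((?w)\<^sup>2 * ?g (hd (j # l)) (hd (j # l)) * ?g (last (j # l)) (last (j # l)))"
    by (simp add: power2_eq_square)
  also have "\<dots> \<le> (?g i i)\<^sup>2 * (\<Prod>i\<leftarrow>j # l. (?g i i)\<^sup>2)"
    by (intro mult_left_mono 1(1)) auto
  finally show ?case by (simp add: power_mult_distrib mult_ac)
qed (auto simp: power2_eq_square)

lemma mat_trace_outer_prod_square_le:
  assumes "l \<noteq> []"
  shows "(mat_trace (outer_prod m y l))\<^sup>2 \<le> (\<Prod>i\<leftarrow>l. (gram m y i i)\<^sup>2)"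
proof -
  let ?g = "gram m y"
  have "(mat_trace (outer_prod m y l))\<^sup>2 = (path_weight ?g l)\<^sup>2 * (?g (last l) (hd l))\<^sup>2"
    by (simp add: cycle_weight_gram[OF assms, symmetric] cycle_weight_def power_mult_distrib)
  also have "\<dots> \<le> (path_weight ?g l)\<^sup>2 * (?g (last l) (last l) * ?g (hd l) (hd l))"
    by (intro mult_left_mono gram_square_le) auto
  also have "\<dots> \<le> (\<Prod>i\<leftarrow>l. (?g i i)\<^sup>2)"
    using path_weight_gram_square_le[OF assms, of m y] by (simp add: mult_ac)
  finally show ?thesis .
qed

lemma schatten_estimator_eq:
  assumes A: "A \<in> carrier_mat m n" and G: "G \<in> carrier_mat n k" and p: "p \<ge> 1"
  shows "schatten_estimator p A G
       = (\<Sum>I | I \<subseteq> {..<k} \<and> card I = p.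
            mat_trace (outer_prod m (\<lambda>j a. (A * G) $$ (a, j)) (sorted_list_of_set I))) / real (k choose p)"
proof -
  let ?y = "\<lambda>j a. (A * G) $$ (a, j)"
  define Z where "Z = transpose_mat (A * G) * (A * G)"
  have Z: "Z \<in> carrier_mat k k" unfolding Z_def using A G by (intro mult_carrier_mat[of _ k m]) auto
  have Zg: "Z $$ (i, j) = gram m ?y i j" if "i < k" "j < k" for i j
  proof -
    have "Z $$ (i, j) = (\<Sum>a<m. transpose_mat (A * G) $$ (i, a) * (A * G) $$ (a, j))"
      unfolding Z_def using A G that by (intro index_mult_mat_sum[of _ k m _ k]) auto
    also have "\<dots> = gram m ?y i j"
      unfolding gram_def using A G that by (intro sum.cong) auto
    finally show ?thesis .
  qed
  have cyc: "cycle_weight (\<lambda>i j. Z $$ (i, j)) l = cycle_weight (gram m ?y) l"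
    if l: "l \<noteq> []" "set l \<subseteq> {..<k}" for l
  proof -
    have "path_weight (\<lambda>i j. Z $$ (i, j)) l = path_weight (gram m ?y) l"
      using l(2) by (induction "gram m ?y" l rule: path_weight.induct) (auto simp: Zg)
    moreover have "hd l < k" "last l < k" using l hd_in_set[of l] last_in_set[of l] by blast+
    ultimately show ?thesis by (simp add: cycle_weight_def Zg)
  qed
  have "schatten_estimator p A G = mat_trace (strict_upper_part Z ^\<^sub>m (p - 1) * Z) / real (k choose p)"
    using G by (simp add: schatten_estimator_def Let_def Z_def)
  also have "mat_trace (strict_upper_part Z ^\<^sub>m (p - 1) * Z)
      = (\<Sum>I | I \<subseteq> {..<k} \<and> card I = p. cycle_weight (\<lambda>i j. Z $$ (i, j)) (sorted_list_of_set I))"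
    using mat_trace_strict_upper_pow_mult[OF Z, of "p - 1"] p by simp
  also have "\<dots> = (\<Sum>I | I \<subseteq> {..<k} \<and> card I = p. mat_trace (outer_prod m ?y (sorted_list_of_set I)))"
  proof (intro sum.cong refl)
    fix I assume I: "I \<in> {I. I \<subseteq> {..<k} \<and> card I = p}"
    then have fin: "finite I" by (auto intro: finite_subset)
    have ne: "sorted_list_of_set I \<noteq> []"
      using I p fin by (metis (mono_tags, lifting) One_nat_def card.empty mem_Collect_eq not_less_eq_eq
          set_empty set_sorted_list_of_set zero_le)
    show "cycle_weight (\<lambda>i j. Z $$ (i, j)) (sorted_list_of_set I)
        = mat_trace (outer_prod m ?y (sorted_list_of_set I))"
      using I fin ne by (simp add: cyc cycle_weight_gram[symmetric])
  qed
  finally show ?thesis .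
qed

section \<open>Gaussian moments\<close>

locale gaussian_family = prob_space M for M :: "'w measure" +
  fixes g :: "'i \<Rightarrow> 'w \<Rightarrow> real" and V :: "'i set"
  assumes indep: "indep_vars (\<lambda>_. borel) g V"
    and gauss: "v \<in> V \<Longrightarrow> distributed M lborel (g v) std_normal_density"
begin

text \<open>An explicit factorisation through the product space takes the place of measurability for
  the sigma-algebra generated by the variables in \<open>D\<close>. Independence of disjoint blocks
  then passes to \<open>f\<close> by composition. The equation holds for every \<omega>, also
  outside \<open>space M\<close>.\<close>

definition depends_on :: "'i set \<Rightarrow> ('w \<Rightarrow> real) \<Rightarrow> bool" where
  "depends_on D f \<longleftrightarrow> D \<subseteq> V \<and>
     (\<exists>\<phi>\<in>borel_measurable (PiM D (\<lambda>_. borel)). \<forall>\<omega>. f \<omega> = \<phi> (\<lambda>v\<in>D. g v \<omega>))"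

text \<open>Both properties survive multiplication over disjoint sets of variables, so long products
  can be treated by induction without a separate integrability argument.\<close>

definition integrable_on_vars :: "'i set \<Rightarrow> ('w \<Rightarrow> real) \<Rightarrow> bool" where
  "integrable_on_vars D f \<longleftrightarrow> depends_on D f \<and> integrable M f"

lemma g_measurable: "v \<in> V \<Longrightarrow> g v \<in> borel_measurable M"
  using indep by (auto simp: indep_vars_def)

lemma depends_onI:
  assumes "D \<subseteq> V" "\<phi> \<in> borel_measurable (PiM D (\<lambda>_. borel))" "\<And>\<omega>. f \<omega> = \<phi> (\<lambda>v\<in>D. g v \<omega>)"
  shows "depends_on D f"
  using assms unfolding depends_on_def by blast

lemma depends_on_var: "v \<in> D \<Longrightarrow> D \<subseteq> V \<Longrightarrow> depends_on D (g v)"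
  by (rule depends_onI[where \<phi> = "\<lambda>x. x v"]) auto

lemma depends_on_const: "D \<subseteq> V \<Longrightarrow> depends_on D (\<lambda>_. c)"
  by (rule depends_onI[where \<phi> = "\<lambda>_. c"]) auto

lemma depends_on_mono:
  assumes "depends_on D f" "D \<subseteq> E" "E \<subseteq> V"
  shows "depends_on E f"
proof -
  obtain \<phi> where \<phi>: "\<phi> \<in> borel_measurable (PiM D (\<lambda>_. borel))"
    and f: "\<And>\<omega>. f \<omega> = \<phi> (\<lambda>v\<in>D. g v \<omega>)"
    using assms unfolding depends_on_def by blast
  show ?thesis
  proof (rule depends_onI[where \<phi> = "\<lambda>x. \<phi> (restrict x D)"])
    show "(\<lambda>x. \<phi> (restrict x D)) \<in> borel_measurable (PiM E (\<lambda>_. borel))"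
      by (rule measurable_compose[OF measurable_restrict_subset \<phi>]) fact
    show "f \<omega> = \<phi> (restrict (\<lambda>v\<in>E. g v \<omega>) D)" for \<omega>
      using assms(2) by (simp add: f restrict_restrict Int_absorb1)
  qed fact
qed

lemma depends_on_add:
  assumes "depends_on D f" "depends_on D h"
  shows "depends_on D (\<lambda>\<omega>. f \<omega> + h \<omega>)"
proof -
  obtain \<phi> \<psi> where "D \<subseteq> V"
    and [measurable]: "\<phi> \<in> borel_measurable (PiM D (\<lambda>_. borel))" "\<psi> \<in> borel_measurable (PiM D (\<lambda>_. borel))"
    and f: "\<And>\<omega>. f \<omega> = \<phi> (\<lambda>v\<in>D. g v \<omega>)" "\<And>\<omega>. h \<omega> = \<psi> (\<lambda>v\<in>D. g v \<omega>)"
    using assms unfolding depends_on_def by blast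
  then show ?thesis
    by (intro depends_onI[where \<phi> = "\<lambda>x. \<phi> x + \<psi> x"]) auto
qed

lemma depends_on_mult:
  assumes "depends_on D f" "depends_on D h"
  shows "depends_on D (\<lambda>\<omega>. f \<omega> * h \<omega>)"
proof -
  obtain \<phi> \<psi> where "D \<subseteq> V"
    and [measurable]: "\<phi> \<in> borel_measurable (PiM D (\<lambda>_. borel))" "\<psi> \<in> borel_measurable (PiM D (\<lambda>_. borel))"
    and f: "\<And>\<omega>. f \<omega> = \<phi> (\<lambda>v\<in>D. g v \<omega>)" "\<And>\<omega>. h \<omega> = \<psi> (\<lambda>v\<in>D. g v \<omega>)"
    using assms unfolding depends_on_def by blast
  then show ?thesis
    by (intro depends_onI[where \<phi> = "\<lambda>x. \<phi> x * \<psi> x"]) auto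
qed

lemma depends_on_sum:
  assumes "D \<subseteq> V" "\<And>x. x \<in> X \<Longrightarrow> depends_on D (f x)"
  shows "depends_on D (\<lambda>\<omega>. \<Sum>x\<in>X. f x \<omega>)"
  using assms(2)
  by (induction X rule: infinite_finite_induct) (auto intro: depends_on_add depends_on_const[OF assms(1)])

lemma integrable_on_varsD:
  assumes "integrable_on_vars D f"
  shows "depends_on D f" "integrable M f" "D \<subseteq> V"
  using assms by (auto simp: integrable_on_vars_def depends_on_def)

lemma integrable_on_vars_const: "D \<subseteq> V \<Longrightarrow> integrable_on_vars D (\<lambda>_. c)"
  by (simp add: integrable_on_vars_def depends_on_const)

lemma integrable_on_vars_sum:
  "D \<subseteq> V \<Longrightarrow> (\<And>x. x \<in> X \<Longrightarrow> integrable_on_vars D (f x)) \<Longrightarrow> integrable_on_vars D (\<lambda>\<omega>. \<Sum>x\<in>X. f x \<omega>)"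
  by (auto simp: integrable_on_vars_def intro!: depends_on_sum)

lemma indep_var_depends_on:
  assumes "depends_on D f" "depends_on E h" "D \<inter> E = {}"
  shows "indep_var borel f borel h"
proof -
  obtain \<phi> where D: "D \<subseteq> V" and \<phi>: "\<phi> \<in> borel_measurable (PiM D (\<lambda>_. borel))"
    and f: "\<And>\<omega>. f \<omega> = \<phi> (\<lambda>v\<in>D. g v \<omega>)"
    using assms unfolding depends_on_def by blast
  obtain \<psi> where E: "E \<subseteq> V" and \<psi>: "\<psi> \<in> borel_measurable (PiM E (\<lambda>_. borel))"
    and h: "\<And>\<omega>. h \<omega> = \<psi> (\<lambda>v\<in>E. g v \<omega>)"
    using assms unfolding depends_on_def by blast
  have "indep_var borel (\<phi> \<circ> (\<lambda>\<omega>. \<lambda>v\<in>D. g v \<omega>)) borel (\<psi> \<circ> (\<lambda>\<omega>. \<lambda>v\<in>E. g v \<omega>))"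
    by (rule indep_var_compose[OF indep_var_restrict[OF indep assms(3) D E] \<phi> \<psi>])
  moreover have "\<phi> \<circ> (\<lambda>\<omega>. \<lambda>v\<in>D. g v \<omega>) = f" "\<psi> \<circ> (\<lambda>\<omega>. \<lambda>v\<in>E. g v \<omega>) = h"
    by (auto simp: f h)
  ultimately show ?thesis by simp
qed

lemma
  assumes "integrable_on_vars D f" "integrable_on_vars E h" "D \<inter> E = {}"
  shows integrable_on_vars_mult: "integrable_on_vars (D \<union> E) (\<lambda>\<omega>. f \<omega> * h \<omega>)"
    and expectation_mult_disjoint: "expectation (\<lambda>\<omega>. f \<omega> * h \<omega>) = expectation f * expectation h"
proof -
  note f = integrable_on_varsD[OF assms(1)] and h = integrable_on_varsD[OF assms(2)]
  have ind: "indep_var borel f borel h"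
    using indep_var_depends_on f h assms(3) by blast
  show "integrable_on_vars (D \<union> E) (\<lambda>\<omega>. f \<omega> * h \<omega>)"
    using f h indep_var_integrable[OF ind]
    by (auto simp: integrable_on_vars_def intro!: depends_on_mult intro: depends_on_mono)
  show "expectation (\<lambda>\<omega>. f \<omega> * h \<omega>) = expectation f * expectation h"
    using indep_var_lebesgue_integral[OF ind] f h by simp
qed

section \<open>Mixed moments of independent standard normals up to order four\<close>

lemma integrable_power_g: "v \<in> V \<Longrightarrow> integrable M (\<lambda>\<omega>. g v \<omega> ^ r)"
  using distributed_integrable[OF gauss, of v "\<lambda>x. x ^ r"] integrable_std_normal_moment[of r] by simp

lemma expectation_power_g:
  assumes "v \<in> V"
  shows "expectation (\<lambda>\<omega>. g v \<omega> ^ r) = (\<integral>x. std_normal_density x * x ^ r \<partial>lborel)"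
  using distributed_integral[OF gauss[OF assms], of "\<lambda>x. x ^ r"] by simp

lemma
  assumes "v \<in> V"
  shows expectation_g: "expectation (g v) = 0"
    and expectation_g_square: "expectation (\<lambda>\<omega>. g v \<omega> * g v \<omega>) = 1"
    and expectation_g_fourth: "expectation (\<lambda>\<omega>. g v \<omega> * g v \<omega> * g v \<omega> * g v \<omega>) = 3"
  using expectation_power_g[OF assms, of 1] expectation_power_g[OF assms, of 2]
    expectation_power_g[OF assms, of 4] integral_std_normal_moment_odd[of 0]
    integral_std_normal_moment_even[of 1] integral_std_normal_moment_even[of 2]
  by (simp_all add: power2_eq_square power4_eq_xxxx fact_numeral mult.assoc)

text \<open>The inequality \<open>2 * \<bar>x * y\<bar> \<le> x^2 + y^2\<close>, used twice,
  dominates the product by the sum of fourth powers. Shorter products are covered by padding with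
  the constant 1.\<close>

lemma integrable_mult_of_fourth_powers:
  fixes f1 f2 f3 f4 :: "'w \<Rightarrow> real"
  assumes "\<And>f. f \<in> {f1, f2, f3, f4} \<Longrightarrow> f \<in> borel_measurable M \<and> integrable M (\<lambda>\<omega>. f \<omega> ^ 4)"
  shows "integrable M (\<lambda>\<omega>. f1 \<omega> * f2 \<omega> * f3 \<omega> * f4 \<omega>)"
proof (rule Bochner_Integration.integrable_bound)
  show "integrable M (\<lambda>\<omega>. f1 \<omega> ^ 4 + f2 \<omega> ^ 4 + f3 \<omega> ^ 4 + f4 \<omega> ^ 4)"
    using assms by auto
  have [measurable]: "f1 \<in> borel_measurable M" "f2 \<in> borel_measurable M"
    "f3 \<in> borel_measurable M" "f4 \<in> borel_measurable M"
    using assms by auto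
  show "(\<lambda>\<omega>. f1 \<omega> * f2 \<omega> * f3 \<omega> * f4 \<omega>) \<in> borel_measurable M"
    by measurable
  have two: "2 * \<bar>x * y\<bar> \<le> x\<^sup>2 + y\<^sup>2" for x y :: real
    using sum_squares_bound[of "\<bar>x\<bar>" "\<bar>y\<bar>"] by (simp add: abs_mult mult.assoc)
  have "\<bar>a * b * c * d\<bar> \<le> a ^ 4 + b ^ 4 + c ^ 4 + d ^ 4" for a b c d :: real
  proof -
    have "2 * \<bar>(a * b) * (c * d)\<bar> \<le> (a * b)\<^sup>2 + (c * d)\<^sup>2" by (rule two)
    moreover have "2 * \<bar>a\<^sup>2 * b\<^sup>2\<bar> \<le> (a\<^sup>2)\<^sup>2 + (b\<^sup>2)\<^sup>2" "2 * \<bar>c\<^sup>2 * d\<^sup>2\<bar> \<le> (c\<^sup>2)\<^sup>2 + (d\<^sup>2)\<^sup>2"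
      by (rule two)+
    moreover have "a ^ 4 \<ge> 0" "b ^ 4 \<ge> 0" "c ^ 4 \<ge> 0" "d ^ 4 \<ge> 0" by auto
    ultimately show ?thesis by (simp add: power_mult_distrib mult.assoc)
  qed
  then show "AE \<omega> in M. norm (f1 \<omega> * f2 \<omega> * f3 \<omega> * f4 \<omega>)
      \<le> norm (f1 \<omega> ^ 4 + f2 \<omega> ^ 4 + f3 \<omega> ^ 4 + f4 \<omega> ^ 4)"
    by (intro AE_I2) (auto intro: order_trans[OF _ abs_ge_self])
qed

lemma integrable_g4:
  assumes "u \<in> V" "v \<in> V" "w \<in> V" "x \<in> V"
  shows "integrable M (\<lambda>\<omega>. g u \<omega> * g v \<omega> * g w \<omega> * g x \<omega>)"
  using assms by (intro integrable_mult_of_fourth_powers) (auto simp: g_measurable integrable_power_g)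

lemma integrable_g3:
  assumes "u \<in> V" "v \<in> V" "w \<in> V"
  shows "integrable M (\<lambda>\<omega>. g u \<omega> * g v \<omega> * g w \<omega>)"
proof -
  have "integrable M (\<lambda>\<omega>. g u \<omega> * g v \<omega> * g w \<omega> * 1)"
    using assms by (intro integrable_mult_of_fourth_powers) (auto simp: g_measurable integrable_power_g)
  then show ?thesis by simp
qed

lemma integrable_g2:
  assumes "u \<in> V" "v \<in> V"
  shows "integrable M (\<lambda>\<omega>. g u \<omega> * g v \<omega>)"
proof -
  have "integrable M (\<lambda>\<omega>. g u \<omega> * g v \<omega> * 1 * 1)"
    using assms by (intro integrable_mult_of_fourth_powers) (auto simp: g_measurable integrable_power_g)
  then show ?thesis by simp
qed

lemma integrable_on_vars_g: "v \<in> V \<Longrightarrow> integrable_on_vars {v} (g v)"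
  using integrable_power_g[of v 1] by (auto simp: integrable_on_vars_def intro!: depends_on_var)

lemma expectation_g_mult:
  assumes "u \<in> V" "v \<in> V"
  shows "expectation (\<lambda>\<omega>. g u \<omega> * g v \<omega>) = of_bool (u = v)"
  using assms expectation_mult_disjoint[of "{u}" "g u" "{v}" "g v"]
  by (auto simp: expectation_g expectation_g_square integrable_on_vars_g)

text \<open>An index occurring only once splits off as an independent factor of mean zero.\<close>

lemma expectation_g4_unpaired:
  assumes "u \<in> V" "v \<in> V" "w \<in> V" "x \<in> V" "u \<notin> {v, w, x}"
  shows "expectation (\<lambda>\<omega>. g u \<omega> * (g v \<omega> * g w \<omega> * g x \<omega>)) = 0"
proof -
  have "integrable_on_vars {v, w, x} (\<lambda>\<omega>. g v \<omega> * g w \<omega> * g x \<omega>)"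
    unfolding integrable_on_vars_def using assms
    by (intro conjI depends_on_mult depends_on_var integrable_g3) auto
  then show ?thesis
    using expectation_mult_disjoint[OF integrable_on_vars_g, of u] assms by (simp add: expectation_g)
qed

lemma expectation_g4_paired:
  assumes "u \<in> V" "v \<in> V" "u \<noteq> v"
  shows "expectation (\<lambda>\<omega>. (g u \<omega> * g u \<omega>) * (g v \<omega> * g v \<omega>)) = 1"
proof -
  have "integrable_on_vars {w} (\<lambda>\<omega>. g w \<omega> * g w \<omega>)" if "w \<in> V" for w
    unfolding integrable_on_vars_def using that
    by (intro conjI depends_on_mult depends_on_var integrable_g2) auto
  then show ?thesis
    using assms by (subst expectation_mult_disjoint[of "{u}" _ "{v}"]) (auto simp: expectation_g_square)
qed

text \<open>Isserlis' theorem for four standard normals. Either some index occurs once, or there are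
  two distinct pairs and exactly one pairing matches, or all four agree; then all three pairings
  count and give the fourth moment 3.\<close>

lemma expectation_g4:
  assumes "u \<in> V" "v \<in> V" "w \<in> V" "x \<in> V"
  shows "expectation (\<lambda>\<omega>. g u \<omega> * g v \<omega> * g w \<omega> * g x \<omega>)
       = of_bool (u = v) * of_bool (w = x) + of_bool (u = w) * of_bool (v = x)
         + of_bool (u = x) * of_bool (v = w)"
proof -
  consider "u \<notin> {v, w, x}" | "v \<notin> {u, w, x}" | "w \<notin> {u, v, x}" | "x \<notin> {u, v, w}"
    | "u = v" "w = x" "u \<noteq> w" | "u = w" "v = x" "u \<noteq> v" | "u = x" "v = w" "u \<noteq> v"
    | "u = v" "v = w" "w = x"
    by blast
  then show ?thesis
  proof cases
    case 1
    then show ?thesis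
      using expectation_g4_unpaired[of u v w x] assms by (auto simp: mult_ac)
  next
    case 2
    then show ?thesis
      using expectation_g4_unpaired[of v u w x] assms by (auto simp: mult_ac)
  next
    case 3
    then show ?thesis
      using expectation_g4_unpaired[of w u v x] assms by (auto simp: mult_ac)
  next
    case 4
    then show ?thesis
      using expectation_g4_unpaired[of x u v w] assms by (auto simp: mult_ac)
  next
    case 5
    then show ?thesis
      using expectation_g4_paired[of u w] assms by (simp add: mult_ac)
  next
    case 6
    then show ?thesis
      using expectation_g4_paired[of u v] assms by (simp add: mult_ac)
  next
    case 7
    then show ?thesis
      using expectation_g4_paired[of u v] assms by (simp add: mult_ac)
  next
    case 8
    then show ?thesis
      using expectation_g_fourth[of u] assms by simp
  qed
qed

end

section \<open>Moments of the sketch\<close>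

lemma pow_mat_Suc_left:
  fixes S :: "real mat"
  assumes "S \<in> carrier_mat m m"
  shows "S ^\<^sub>m Suc q = S * S ^\<^sub>m q"
  using pow_mat_mult_intertwine[of "1\<^sub>m m" m m S q] assms by simp

lemma transpose_pow_mat_symmetric:
  fixes S :: "real mat"
  assumes S: "S \<in> carrier_mat m m" and sym: "transpose_mat S = S"
  shows "transpose_mat (S ^\<^sub>m q) = S ^\<^sub>m q"
proof (induction q)
  case (Suc q)
  have "transpose_mat (S ^\<^sub>m Suc q) = S * S ^\<^sub>m q"
    using transpose_mult[OF pow_carrier_mat[OF S] S, of q] by (simp add: Suc sym)
  then show ?case using pow_mat_Suc_left[OF S] by simp
qed (use S in simp)

lemma symmetric_mat_index:
  assumes "transpose_mat S = S" "S \<in> carrier_mat m m" "a < m" "b < m"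
  shows "S $$ (a, b) = S $$ (b, a)"
  using assms by (metis carrier_matD index_transpose_mat(1))

lemma sum_sum_mult_sum_sum:
  fixes f h :: "'a \<Rightarrow> 'b \<Rightarrow> real"
  shows "(\<Sum>a\<in>X. \<Sum>b\<in>Y. f a b) * (\<Sum>c\<in>X. \<Sum>d\<in>Y. h c d)
    = (\<Sum>a\<in>X. \<Sum>b\<in>Y. \<Sum>c\<in>X. \<Sum>d\<in>Y. f a b * h c d)"
  by (simp only: sum_distrib_left[symmetric] sum_distrib_right[symmetric])

lemma mat_trace_mult4:
  fixes B C D E :: "real mat"
  assumes B: "B \<in> carrier_mat m m" and C: "C \<in> carrier_mat m m"
    and D: "D \<in> carrier_mat m m" and E: "E \<in> carrier_mat m m"
  shows "mat_trace (B * C * (D * E))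
    = (\<Sum>a<m. \<Sum>b<m. \<Sum>c<m. \<Sum>d<m. B $$ (a, b) * C $$ (b, c) * D $$ (c, d) * E $$ (d, a))"
proof -
  have "mat_trace (B * C * (D * E)) = (\<Sum>a<m. \<Sum>c<m. (B * C) $$ (a, c) * (D * E) $$ (c, a))"
    unfolding mat_trace_carrier[OF mult_carrier_mat[OF mult_carrier_mat[OF B C] mult_carrier_mat[OF D E]]]
    using B C D E by (intro sum.cong refl index_mult_mat_sum[of _ m m _ m]) auto
  also have "\<dots> = (\<Sum>a<m. \<Sum>c<m. (\<Sum>b<m. B $$ (a, b) * C $$ (b, c)) * (\<Sum>d<m. D $$ (c, d) * E $$ (d, a)))"
    by (intro sum.cong refl arg_cong2[of _ _ _ _ times] index_mult_mat_sum[OF B C] index_mult_mat_sum[OF D E]) auto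
  also have "\<dots> = (\<Sum>a<m. \<Sum>c<m. \<Sum>b<m. \<Sum>d<m. B $$ (a, b) * C $$ (b, c) * D $$ (c, d) * E $$ (d, a))"
    by (simp add: sum_product mult.assoc)
  also have "\<dots> = (\<Sum>a<m. \<Sum>b<m. \<Sum>c<m. \<Sum>d<m. B $$ (a, b) * C $$ (b, c) * D $$ (c, d) * E $$ (d, a))"
    by (rule sum.cong[OF refl]) (rule sum.swap)
  finally show ?thesis .
qed

locale gaussian_sketch = gaussian_family M g "{..<n} \<times> {..<k}"
  for M :: "'w measure" and g :: "nat \<times> nat \<Rightarrow> 'w \<Rightarrow> real" and n k :: nat +
  fixes A :: "real mat" and m :: nat
  assumes A: "A \<in> carrier_mat m n"
begin

text \<open>An explicit sum in the variables \<open>g\<close>, so that \<open>depends_on\<close>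
  holds at every \<omega>. It is linked to the entries of the sketched matrix only on
  \<open>space M\<close>, where the dimensions of the sketch are known.\<close>

definition y :: "'w \<Rightarrow> nat \<Rightarrow> nat \<Rightarrow> real" where
  "y \<omega> j a = (\<Sum>i<n. A $$ (a, i) * g (i, j) \<omega>)"

definition S :: "real mat" where "S = A * transpose_mat A"

abbreviation cols :: "nat set \<Rightarrow> (nat \<times> nat) set" where "cols J \<equiv> {..<n} \<times> J"

lemma S_carrier [simp]: "S \<in> carrier_mat m m"
  using A by (simp add: S_def)

lemma S_sym: "transpose_mat S = S"
  using A by (simp add: S_def transpose_mult[of _ m n])

lemma S_pow_carrier [simp]: "S ^\<^sub>m q \<in> carrier_mat m m"
  by simp

lemma S_index:
  assumes "a < m" "b < m"
  shows "S $$ (a, b) = (\<Sum>i<n. A $$ (a, i) * A $$ (b, i))"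
proof -
  have "S $$ (a, b) = (\<Sum>i<n. A $$ (a, i) * transpose_mat A $$ (i, b))"
    unfolding S_def using A assms by (intro index_mult_mat_sum[of _ m n _ m]) auto
  then show ?thesis using A assms by simp
qed

lemma depends_on_y: "j < k \<Longrightarrow> depends_on (cols {j}) (\<lambda>\<omega>. y \<omega> j a)"
  unfolding y_def
  by (intro depends_on_sum depends_on_mult depends_on_const depends_on_var) auto

lemma y4_expand:
  "y \<omega> j a * y \<omega> j b * y \<omega> j c * y \<omega> j d
     = (\<Sum>p<n. \<Sum>q<n. \<Sum>r<n. \<Sum>s<n. A $$ (a, p) * A $$ (b, q) * A $$ (c, r) * A $$ (d, s)
         * (g (p, j) \<omega> * g (q, j) \<omega> * g (r, j) \<omega> * g (s, j) \<omega>))"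
proof -
  have product: "sum f X * sum f' X * sum h X * sum h' X = (\<Sum>p\<in>X. \<Sum>q\<in>X. \<Sum>r\<in>X. \<Sum>s\<in>X. f p * f' q * h r * h' s)"
    for f f' h h' :: "nat \<Rightarrow> real" and X
    by (simp only: sum_distrib_left[symmetric] sum_distrib_right[symmetric])
  show ?thesis
    unfolding y_def product by (intro sum.cong refl) (simp only: mult_ac)
qed

lemma has_bochner_integral_y2:
  assumes "j < k" "a < m" "b < m"
  shows "has_bochner_integral M (\<lambda>\<omega>. y \<omega> j a * y \<omega> j b) (S $$ (a, b))"
proof -
  have "has_bochner_integral M
      (\<lambda>\<omega>. \<Sum>p<n. \<Sum>q<n. A $$ (a, p) * A $$ (b, q) * (g (p, j) \<omega> * g (q, j) \<omega>))
      (\<Sum>p<n. \<Sum>q<n. A $$ (a, p) * A $$ (b, q) * expectation (\<lambda>\<omega>. g (p, j) \<omega> * g (q, j) \<omega>))"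
    using assms
    by (intro has_bochner_integral_sum has_bochner_integral_mult_right has_bochner_integral_integrable
        integrable_g2) auto
  also have "(\<lambda>\<omega>. \<Sum>p<n. \<Sum>q<n. A $$ (a, p) * A $$ (b, q) * (g (p, j) \<omega> * g (q, j) \<omega>))
      = (\<lambda>\<omega>. y \<omega> j a * y \<omega> j b)"
    unfolding y_def by (simp add: sum_product mult_ac)
  also have "(\<Sum>p<n. \<Sum>q<n. A $$ (a, p) * A $$ (b, q) * expectation (\<lambda>\<omega>. g (p, j) \<omega> * g (q, j) \<omega>))
      = (\<Sum>p<n. \<Sum>q<n. if p = q then A $$ (a, p) * A $$ (b, p) else 0)"
    using assms by (intro sum.cong refl) (auto simp: expectation_g_mult)
  also have "\<dots> = S $$ (a, b)"
    using assms by (simp add: S_index)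
  finally show ?thesis .
qed

text \<open>The pairings of the normals carry over by linearity: each Kronecker delta contracts two
  rows of \<open>A\<close> to an entry of \<open>S\<close>, the covariance matrix of a
  column.\<close>

lemma has_bochner_integral_y4:
  assumes "j < k" "a < m" "b < m" "c < m" "d < m"
  shows "has_bochner_integral M (\<lambda>\<omega>. y \<omega> j a * y \<omega> j b * y \<omega> j c * y \<omega> j d)
    (S $$ (a, b) * S $$ (c, d) + S $$ (a, c) * S $$ (b, d) + S $$ (a, d) * S $$ (b, c))"
proof -
  define \<delta> :: "nat \<Rightarrow> nat \<Rightarrow> real" where "\<delta> p q = of_bool (p = q)" for p q
  have delta: "(\<Sum>s<n. \<delta> p s * f s) = f p" if "p < n" for p and f :: "nat \<Rightarrow> real"
    using that by (simp add: \<delta>_def of_bool_def if_distrib[of "\<lambda>x. x * _"] cong: if_cong)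
  let ?c = "\<lambda>p q r s. A $$ (a, p) * A $$ (b, q) * A $$ (c, r) * A $$ (d, s)"
  have 1: "(\<Sum>p<n. \<Sum>q<n. \<Sum>r<n. \<Sum>s<n. ?c p q r s * (\<delta> p q * \<delta> r s)) = S $$ (a, b) * S $$ (c, d)"
  proof -
    have "(\<Sum>p<n. \<Sum>q<n. \<Sum>r<n. \<Sum>s<n. ?c p q r s * (\<delta> p q * \<delta> r s))
        = (\<Sum>p<n. \<Sum>q<n. (\<Sum>r<n. \<Sum>s<n. ?c p q r s * \<delta> r s) * \<delta> p q)"
      by (simp add: sum_distrib_left sum_distrib_right mult_ac)
    also have "\<dots> = (\<Sum>p<n. \<Sum>r<n. (A $$ (a, p) * A $$ (b, p)) * (A $$ (c, r) * A $$ (d, r)))"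
      by (simp add: delta mult_ac)
    finally show ?thesis using assms by (simp add: S_index sum_product)
  qed
  have 2: "(\<Sum>p<n. \<Sum>q<n. \<Sum>r<n. \<Sum>s<n. ?c p q r s * (\<delta> p r * \<delta> q s)) = S $$ (a, c) * S $$ (b, d)"
  proof -
    have "(\<Sum>p<n. \<Sum>q<n. \<Sum>r<n. \<Sum>s<n. ?c p q r s * (\<delta> p r * \<delta> q s))
        = (\<Sum>p<n. \<Sum>q<n. \<Sum>r<n. (\<Sum>s<n. ?c p q r s * \<delta> q s) * \<delta> p r)"
      by (simp add: sum_distrib_left sum_distrib_right mult_ac)
    also have "\<dots> = (\<Sum>p<n. \<Sum>q<n. (A $$ (a, p) * A $$ (c, p)) * (A $$ (b, q) * A $$ (d, q)))"
      by (simp add: delta mult_ac)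
    finally show ?thesis using assms by (simp add: S_index sum_product)
  qed
  have 3: "(\<Sum>p<n. \<Sum>q<n. \<Sum>r<n. \<Sum>s<n. ?c p q r s * (\<delta> p s * \<delta> q r)) = S $$ (a, d) * S $$ (b, c)"
  proof -
    have "(\<Sum>p<n. \<Sum>q<n. \<Sum>r<n. \<Sum>s<n. ?c p q r s * (\<delta> p s * \<delta> q r))
        = (\<Sum>p<n. \<Sum>q<n. \<Sum>r<n. (\<Sum>s<n. ?c p q r s * \<delta> p s) * \<delta> q r)"
      by (simp add: sum_distrib_left sum_distrib_right mult_ac)
    also have "\<dots> = (\<Sum>p<n. \<Sum>q<n. (A $$ (a, p) * A $$ (d, p)) * (A $$ (b, q) * A $$ (c, q)))"
      by (simp add: delta mult_ac)
    finally show ?thesis using assms by (simp add: S_index sum_product)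
  qed
  have "has_bochner_integral M (\<lambda>\<omega>. y \<omega> j a * y \<omega> j b * y \<omega> j c * y \<omega> j d)
      (\<Sum>p<n. \<Sum>q<n. \<Sum>r<n. \<Sum>s<n. ?c p q r s
         * expectation (\<lambda>\<omega>. g (p, j) \<omega> * g (q, j) \<omega> * g (r, j) \<omega> * g (s, j) \<omega>))"
    unfolding y4_expand using assms
    by (intro has_bochner_integral_sum has_bochner_integral_mult_right has_bochner_integral_integrable
        integrable_g4) auto
  also have "(\<Sum>p<n. \<Sum>q<n. \<Sum>r<n. \<Sum>s<n. ?c p q r s
         * expectation (\<lambda>\<omega>. g (p, j) \<omega> * g (q, j) \<omega> * g (r, j) \<omega> * g (s, j) \<omega>))
      = (\<Sum>p<n. \<Sum>q<n. \<Sum>r<n. \<Sum>s<n. ?c p q r s * (\<delta> p q * \<delta> r s + \<delta> p r * \<delta> q s + \<delta> p s * \<delta> q r))"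
  proof (intro sum.cong refl)
    fix p q r s assume "p \<in> {..<n}" "q \<in> {..<n}" "r \<in> {..<n}" "s \<in> {..<n}"
    then show "?c p q r s * expectation (\<lambda>\<omega>. g (p, j) \<omega> * g (q, j) \<omega> * g (r, j) \<omega> * g (s, j) \<omega>)
        = ?c p q r s * (\<delta> p q * \<delta> r s + \<delta> p r * \<delta> q s + \<delta> p s * \<delta> q r)"
      using assms by (subst expectation_g4) (auto simp: \<delta>_def)
  qed
  also have "\<dots> = S $$ (a, b) * S $$ (c, d) + S $$ (a, c) * S $$ (b, d) + S $$ (a, d) * S $$ (b, c)"
    unfolding distrib_left sum.distrib 1 2 3 ..
  finally show ?thesis .
qed

lemmas integrable_y2 = has_bochner_integral_y2[THEN integrable.intros]
lemmas integrable_y4 = has_bochner_integral_y4[THEN integrable.intros]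
lemmas expectation_y2 = has_bochner_integral_y2[THEN has_bochner_integral_integral_eq]
lemmas expectation_y4 = has_bochner_integral_y4[THEN has_bochner_integral_integral_eq]

abbreviation prod_entry :: "nat list \<Rightarrow> nat \<Rightarrow> nat \<Rightarrow> 'w \<Rightarrow> real" where
  "prod_entry l a b \<omega> \<equiv> outer_prod m (y \<omega>) l $$ (a, b)"

lemma integrable_on_vars_yy:
  "j < k \<Longrightarrow> a < m \<Longrightarrow> b < m \<Longrightarrow> integrable_on_vars (cols {j}) (\<lambda>\<omega>. y \<omega> j a * y \<omega> j b)"
  unfolding integrable_on_vars_def
  by (intro conjI depends_on_mult depends_on_y integrable_y2)

text \<open>The induction runs on entries because a trace does not factor over the columns, whereas
  an entry is a sum of products of a term in the first column and an entry in the others.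
  Distinctness of the list makes these independent.\<close>

lemma
  assumes "distinct l" "set l \<subseteq> {..<k}" "a < m" "b < m"
  shows integrable_on_vars_outer_prod: "integrable_on_vars (cols (set l)) (prod_entry l a b)"
    and expectation_outer_prod: "expectation (prod_entry l a b) = (S ^\<^sub>m length l) $$ (a, b)"
proof -
  have "integrable_on_vars (cols (set l)) (prod_entry l a b)
      \<and> expectation (prod_entry l a b) = (S ^\<^sub>m length l) $$ (a, b)"
    using assms
  proof (induction l arbitrary: a)
    case Nil
    then show ?case by (simp add: integrable_on_vars_const prob_space carrier_matD[OF S_carrier])
  next
    case (Cons j l)
    have step: "prod_entry (j # l) a b \<omega> = (\<Sum>c<m. (y \<omega> j a * y \<omega> j c) * prod_entry l c b \<omega>)" for \<omega>
      using Cons.prems index_mult_mat_sum[OF outer_mat_carrier outer_prod_carrier, of a m b "y \<omega>" j "y \<omega>" l]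
      by (simp add: outer_mat_def)
    have dis: "cols {j} \<inter> cols (set l) = {}" using Cons.prems by auto
    have un: "cols {j} \<union> cols (set l) = cols (set (j # l))" by auto
    have IH: "integrable_on_vars (cols (set l)) (prod_entry l c b)"
      "expectation (prod_entry l c b) = (S ^\<^sub>m length l) $$ (c, b)" if "c < m" for c
      using Cons that by auto
    have yy: "integrable_on_vars (cols {j}) (\<lambda>\<omega>. y \<omega> j a * y \<omega> j c)" if "c < m" for c
      using Cons.prems that by (intro integrable_on_vars_yy) auto
    have mult: "integrable_on_vars (cols (set (j # l))) (\<lambda>\<omega>. (y \<omega> j a * y \<omega> j c) * prod_entry l c b \<omega>)"
      if "c < m" for c
      using integrable_on_vars_mult[OF yy[OF that] IH(1)[OF that] dis] unfolding un .
    have 1: "integrable_on_vars (cols (set (j # l))) (prod_entry (j # l) a b)"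
      unfolding step using Cons.prems by (intro integrable_on_vars_sum mult) auto
    have "expectation (prod_entry (j # l) a b)
        = (\<Sum>c<m. expectation (\<lambda>\<omega>. (y \<omega> j a * y \<omega> j c) * prod_entry l c b \<omega>))"
      unfolding step by (intro Bochner_Integration.integral_sum integrable_on_varsD(2)[OF mult]) auto
    also have "\<dots> = (\<Sum>c<m. S $$ (a, c) * (S ^\<^sub>m length l) $$ (c, b))"
      using Cons.prems
      by (intro sum.cong refl) (simp add: expectation_mult_disjoint[OF yy IH(1) dis] IH(2) expectation_y2)
    also have "\<dots> = (S * S ^\<^sub>m length l) $$ (a, b)"
      using Cons.prems by (intro index_mult_mat_sum[symmetric, of _ m m _ m]) auto
    also have "S * S ^\<^sub>m length l = S ^\<^sub>m length (j # l)"
      by (simp add: pow_mat_Suc_left[OF S_carrier, symmetric])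
    finally show ?case using 1 by simp
  qed
  then show "integrable_on_vars (cols (set l)) (prod_entry l a b)"
    "expectation (prod_entry l a b) = (S ^\<^sub>m length l) $$ (a, b)"
    by auto
qed

abbreviation trace_prod :: "nat list \<Rightarrow> 'w \<Rightarrow> real" where
  "trace_prod l \<omega> \<equiv> mat_trace (outer_prod m (y \<omega>) l)"

lemma
  assumes "distinct l" "set l \<subseteq> {..<k}"
  shows integrable_on_vars_trace_prod: "integrable_on_vars (cols (set l)) (trace_prod l)"
    and expectation_trace_prod: "expectation (trace_prod l) = mat_trace (S ^\<^sub>m length l)"
proof -
  have eq: "trace_prod l \<omega> = (\<Sum>a<m. prod_entry l a a \<omega>)" for \<omega>
    by (rule mat_trace_carrier) simp
  show "integrable_on_vars (cols (set l)) (trace_prod l)"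
    unfolding eq using assms
    by (intro integrable_on_vars_sum integrable_on_vars_outer_prod) auto
  have "expectation (trace_prod l) = (\<Sum>a<m. expectation (prod_entry l a a))"
    unfolding eq using assms
    by (intro Bochner_Integration.integral_sum integrable_on_varsD(2)[OF integrable_on_vars_outer_prod]) auto
  also have "\<dots> = mat_trace (S ^\<^sub>m length l)"
    using assms by (simp add: expectation_outer_prod mat_trace_carrier[OF S_pow_carrier])
  finally show "expectation (trace_prod l) = mat_trace (S ^\<^sub>m length l)" .
qed

lemma S_pow_add: "S ^\<^sub>m (r + s) = S ^\<^sub>m r * S ^\<^sub>m s"
proof (induction s)
  case 0
  then show ?case using right_mult_one_mat[OF S_pow_carrier] by (simp add: carrier_matD[OF S_carrier])
next
  case (Suc s)
  then show ?case
    using assoc_mult_mat[OF S_pow_carrier S_pow_carrier S_carrier, of r s] by simp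
qed

text \<open>The fourth moment of the Euclidean norm of a column. Of the three pairings one gives the
  square of the trace of \<open>S\<close>, and each of the other two the sum of the squared entries
  of \<open>S\<close>.\<close>

definition K :: real where "K = (mat_trace S)\<^sup>2 + 2 * mat_trace (S ^\<^sub>m 2)"

lemma has_bochner_integral_gram_square:
  assumes "j < k"
  shows "has_bochner_integral M (\<lambda>\<omega>. (gram m (y \<omega>) j j)\<^sup>2) K"
proof -
  have "has_bochner_integral M (\<lambda>\<omega>. \<Sum>a<m. \<Sum>b<m. y \<omega> j a * y \<omega> j a * y \<omega> j b * y \<omega> j b)
      (\<Sum>a<m. \<Sum>b<m. S $$ (a, a) * S $$ (b, b) + S $$ (a, b) * S $$ (a, b) + S $$ (a, b) * S $$ (a, b))"
    using assms by (intro has_bochner_integral_sum has_bochner_integral_y4) auto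
  also have "(\<lambda>\<omega>. \<Sum>a<m. \<Sum>b<m. y \<omega> j a * y \<omega> j a * y \<omega> j b * y \<omega> j b) = (\<lambda>\<omega>. (gram m (y \<omega>) j j)\<^sup>2)"
    by (simp add: gram_def power2_eq_square sum_product mult.assoc)
  also have "(\<Sum>a<m. \<Sum>b<m. S $$ (a, a) * S $$ (b, b) + S $$ (a, b) * S $$ (a, b) + S $$ (a, b) * S $$ (a, b))
      = (mat_trace S)\<^sup>2 + 2 * (\<Sum>a<m. \<Sum>b<m. S $$ (a, b) * S $$ (a, b))"
    unfolding mat_trace_carrier[OF S_carrier] power2_eq_square sum_product
    by (simp add: sum.distrib sum_distrib_left)
  also have "(\<Sum>a<m. \<Sum>b<m. S $$ (a, b) * S $$ (a, b)) = (\<Sum>a<m. (S * S) $$ (a, a))"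
  proof (intro sum.cong refl)
    fix a assume a: "a \<in> {..<m}"
    have "(\<Sum>b<m. S $$ (a, b) * S $$ (a, b)) = (\<Sum>b<m. S $$ (a, b) * S $$ (b, a))"
      using a symmetric_mat_index[OF S_sym S_carrier] by (intro sum.cong refl) auto
    then show "(\<Sum>b<m. S $$ (a, b) * S $$ (a, b)) = (S * S) $$ (a, a)"
      using a index_mult_mat_sum[OF S_carrier S_carrier, of a a] by simp
  qed
  also have "\<dots> = mat_trace (S ^\<^sub>m 2)"
    using S_pow_add[of 1 1] left_mult_one_mat[OF S_carrier]
      mat_trace_carrier[OF mult_carrier_mat[OF S_carrier S_carrier]]
    by (simp add: carrier_matD[OF S_carrier] numeral_2_eq_2 del: index_mult_mat)
  finally show ?thesis by (simp add: K_def)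
qed

section \<open>Second-moment bounds for the traces\<close>

lemma
  assumes "distinct l" "set l \<subseteq> {..<k}"
  shows integrable_on_vars_gram_prod:
      "integrable_on_vars (cols (set l)) (\<lambda>\<omega>. \<Prod>j\<leftarrow>l. (gram m (y \<omega>) j j)\<^sup>2)"
    and expectation_gram_prod: "expectation (\<lambda>\<omega>. \<Prod>j\<leftarrow>l. (gram m (y \<omega>) j j)\<^sup>2) = K ^ length l"
proof -
  have "integrable_on_vars (cols (set l)) (\<lambda>\<omega>. \<Prod>j\<leftarrow>l. (gram m (y \<omega>) j j)\<^sup>2)
      \<and> expectation (\<lambda>\<omega>. \<Prod>j\<leftarrow>l. (gram m (y \<omega>) j j)\<^sup>2) = K ^ length l"
    using assms
  proof (induction l)
    case Nil
    then show ?case by (simp add: integrable_on_vars_const prob_space)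
  next
    case (Cons j l)
    have dis: "cols {j} \<inter> cols (set l) = {}" using Cons.prems by auto
    have un: "cols {j} \<union> cols (set l) = cols (set (j # l))" by auto
    have "depends_on (cols {j}) (\<lambda>\<omega>. (gram m (y \<omega>) j j)\<^sup>2)"
      unfolding gram_def power2_eq_square using Cons.prems
      by (intro depends_on_mult depends_on_sum depends_on_y) auto
    then have j: "integrable_on_vars (cols {j}) (\<lambda>\<omega>. (gram m (y \<omega>) j j)\<^sup>2)"
      using has_bochner_integral_gram_square[of j] Cons.prems
      by (auto simp: integrable_on_vars_def has_bochner_integral_iff)
    have l: "integrable_on_vars (cols (set l)) (\<lambda>\<omega>. \<Prod>j\<leftarrow>l. (gram m (y \<omega>) j j)\<^sup>2)"
      "expectation (\<lambda>\<omega>. \<Prod>j\<leftarrow>l. (gram m (y \<omega>) j j)\<^sup>2) = K ^ length l"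
      using Cons by auto
    have "expectation (\<lambda>\<omega>. (gram m (y \<omega>) j j)\<^sup>2) = K"
      using has_bochner_integral_gram_square[of j] Cons.prems by (simp add: has_bochner_integral_iff)
    then show ?case
      using integrable_on_vars_mult[OF j l(1) dis] expectation_mult_disjoint[OF j l(1) dis] l(2)
      unfolding un by simp
  qed
  then show "integrable_on_vars (cols (set l)) (\<lambda>\<omega>. \<Prod>j\<leftarrow>l. (gram m (y \<omega>) j j)\<^sup>2)"
    "expectation (\<lambda>\<omega>. \<Prod>j\<leftarrow>l. (gram m (y \<omega>) j j)\<^sup>2) = K ^ length l"
    by auto
qed

text \<open>The squared trace couples all columns and does not factor; the product of fourth powers
  of column norms that dominates it does, and it provides both integrability and the bound.\<close>

lemma
  assumes "distinct l" "set l \<subseteq> {..<k}" "l \<noteq> []"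
  shows integrable_trace_prod_square: "integrable M (\<lambda>\<omega>. (trace_prod l \<omega>)\<^sup>2)"
    and expectation_trace_prod_square_le: "expectation (\<lambda>\<omega>. (trace_prod l \<omega>)\<^sup>2) \<le> K ^ length l"
proof -
  have [measurable]: "trace_prod l \<in> borel_measurable M"
    using integrable_on_vars_trace_prod[OF assms(1,2)] by (auto simp: integrable_on_vars_def)
  have g: "integrable M (\<lambda>\<omega>. \<Prod>j\<leftarrow>l. (gram m (y \<omega>) j j)\<^sup>2)"
    by (rule integrable_on_varsD(2)[OF integrable_on_vars_gram_prod[OF assms(1,2)]])
  show sq: "integrable M (\<lambda>\<omega>. (trace_prod l \<omega>)\<^sup>2)"
    by (rule Bochner_Integration.integrable_bound[OF g])
       (auto intro: order_trans[OF mat_trace_outer_prod_square_le[OF assms(3)] abs_ge_self])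
  show "expectation (\<lambda>\<omega>. (trace_prod l \<omega>)\<^sup>2) \<le> K ^ length l"
    unfolding expectation_gram_prod[OF assms(1,2), symmetric]
    by (intro integral_mono sq g mat_trace_outer_prod_square_le assms(3))
qed

text \<open>The arithmetic-geometric mean inequality reduces the mixed term to two second moments;
  equal lengths bound both by the same power of \<open>K\<close>.\<close>

lemma
  assumes l: "distinct l" "set l \<subseteq> {..<k}" "l \<noteq> []"
    and l': "distinct l'" "set l' \<subseteq> {..<k}" "l' \<noteq> []" "length l' = length l"
  shows integrable_trace_prod_mult: "integrable M (\<lambda>\<omega>. trace_prod l \<omega> * trace_prod l' \<omega>)"
    and expectation_trace_prod_mult_le:
      "\<bar>expectation (\<lambda>\<omega>. trace_prod l \<omega> * trace_prod l' \<omega>)\<bar> \<le> K ^ length l"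
proof -
  have [measurable]: "trace_prod l \<in> borel_measurable M" "trace_prod l' \<in> borel_measurable M"
    using integrable_on_vars_trace_prod[OF l(1,2)] integrable_on_vars_trace_prod[OF l'(1,2)]
    by (auto simp: integrable_on_vars_def)
  let ?h = "\<lambda>\<omega>. ((trace_prod l \<omega>)\<^sup>2 + (trace_prod l' \<omega>)\<^sup>2) / 2"
  note sq = integrable_trace_prod_square[OF l] integrable_trace_prod_square[OF l'(1-3)]
  have h: "integrable M ?h" using sq by simp
  have le: "\<bar>a * b\<bar> \<le> (a\<^sup>2 + b\<^sup>2) / 2" for a b :: real
    using sum_squares_bound[of "\<bar>a\<bar>" "\<bar>b\<bar>"] by (simp add: abs_mult)
  show i: "integrable M (\<lambda>\<omega>. trace_prod l \<omega> * trace_prod l' \<omega>)"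
  proof (rule Bochner_Integration.integrable_bound[OF h])
    show "AE \<omega> in M. norm (trace_prod l \<omega> * trace_prod l' \<omega>) \<le> norm (?h \<omega>)"
      unfolding real_norm_def by (intro AE_I2 order_trans[OF le abs_ge_self])
  qed measurable
  have "\<bar>expectation (\<lambda>\<omega>. trace_prod l \<omega> * trace_prod l' \<omega>)\<bar>
      \<le> expectation (\<lambda>\<omega>. \<bar>trace_prod l \<omega> * trace_prod l' \<omega>\<bar>)"
    by (rule integral_abs_bound)
  also have "\<dots> \<le> expectation ?h"
    by (intro integral_mono integrable_abs i h le)
  also have "\<dots> = (expectation (\<lambda>\<omega>. (trace_prod l \<omega>)\<^sup>2) + expectation (\<lambda>\<omega>. (trace_prod l' \<omega>)\<^sup>2)) / 2"
    using sq by simp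
  also have "\<dots> \<le> K ^ length l"
    using expectation_trace_prod_square_le[OF l] expectation_trace_prod_square_le[OF l'(1-3)] l'(4) by simp
  finally show "\<bar>expectation (\<lambda>\<omega>. trace_prod l \<omega> * trace_prod l' \<omega>)\<bar> \<le> K ^ length l" .
qed

lemma expectation_trace_prod_mult_disjoint:
  assumes "distinct l" "set l \<subseteq> {..<k}" "distinct l'" "set l' \<subseteq> {..<k}" "set l \<inter> set l' = {}"
  shows "expectation (\<lambda>\<omega>. trace_prod l \<omega> * trace_prod l' \<omega>)
       = mat_trace (S ^\<^sub>m length l) * mat_trace (S ^\<^sub>m length l')"
proof -
  have "cols (set l) \<inter> cols (set l') = {}" using assms by auto
  then show ?thesis
    using assms expectation_mult_disjoint[OF integrable_on_vars_trace_prod integrable_on_vars_trace_prod, of l l']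
    by (simp add: expectation_trace_prod)
qed

text \<open>The pairings of the common column, contracted with the means
  \<open>S ^\<^sub>m q\<close> of the two remaining products. The first closes each trace
  separately. The other two thread both copies of \<open>S ^\<^sub>m q\<close> onto one cycle, and
  they agree because \<open>S\<close> and its powers are symmetric: one of them traverses a copy
  backwards.\<close>

lemma sum_contract4:
  "(\<Sum>a<m. \<Sum>b<m. \<Sum>c<m. \<Sum>d<m.
      (S $$ (a, b) * S $$ (c, d) + S $$ (a, c) * S $$ (b, d) + S $$ (a, d) * S $$ (b, c))
        * ((S ^\<^sub>m q) $$ (b, a) * (S ^\<^sub>m q) $$ (d, c)))
    = (mat_trace (S ^\<^sub>m Suc q))\<^sup>2 + 2 * mat_trace (S ^\<^sub>m (2 * Suc q))"
proof -
  let ?R = "S ^\<^sub>m q"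
  have R: "?R \<in> carrier_mat m m" by simp
  have S_swap: "S $$ (a, b) = S $$ (b, a)" and R_swap: "?R $$ (a, b) = ?R $$ (b, a)" if "a < m" "b < m" for a b
    using symmetric_mat_index[OF S_sym S_carrier that]
      symmetric_mat_index[OF transpose_pow_mat_symmetric[OF S_carrier S_sym] R that] by auto
  have SR: "S * ?R = S ^\<^sub>m Suc q" by (rule pow_mat_Suc_left[OF S_carrier, symmetric])
  have tr: "(\<Sum>a<m. \<Sum>b<m. S $$ (a, b) * ?R $$ (b, a)) = mat_trace (S ^\<^sub>m Suc q)"
    unfolding SR[symmetric] mat_trace_carrier[OF mult_carrier_mat[OF S_carrier R]]
    by (intro sum.cong refl index_mult_mat_sum[OF S_carrier R, symmetric]) auto
  have 1: "(\<Sum>a<m. \<Sum>b<m. \<Sum>c<m. \<Sum>d<m. S $$ (a, b) * S $$ (c, d) * (?R $$ (b, a) * ?R $$ (d, c)))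
      = (mat_trace (S ^\<^sub>m Suc q))\<^sup>2"
    unfolding tr[symmetric] power2_eq_square
    unfolding sum_sum_mult_sum_sum by (simp add: mult_ac)
  have "S ^\<^sub>m (2 * Suc q) = S * ?R * (S * ?R)"
    unfolding SR mult_2 by (rule S_pow_add)
  then have tr4: "mat_trace (S ^\<^sub>m (2 * Suc q))
      = (\<Sum>a<m. \<Sum>b<m. \<Sum>c<m. \<Sum>d<m. S $$ (a, b) * ?R $$ (b, c) * S $$ (c, d) * ?R $$ (d, a))"
    using mat_trace_mult4[OF S_carrier R S_carrier R] by simp
  have rot: "(\<Sum>b<m. \<Sum>c<m. \<Sum>d<m. f b c d) = (\<Sum>c<m. \<Sum>d<m. \<Sum>b<m. f b c d)"
    for f :: "nat \<Rightarrow> nat \<Rightarrow> nat \<Rightarrow> real"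
    by (subst sum.swap, rule sum.cong[OF refl], rule sum.swap)
  have 2: "(\<Sum>a<m. \<Sum>b<m. \<Sum>c<m. \<Sum>d<m. S $$ (a, c) * S $$ (b, d) * (?R $$ (b, a) * ?R $$ (d, c)))
      = mat_trace (S ^\<^sub>m (2 * Suc q))"
  proof -
    have "(\<Sum>a<m. \<Sum>b<m. \<Sum>c<m. \<Sum>d<m. S $$ (a, c) * S $$ (b, d) * (?R $$ (b, a) * ?R $$ (d, c)))
        = (\<Sum>a<m. \<Sum>c<m. \<Sum>d<m. \<Sum>b<m. S $$ (a, c) * S $$ (b, d) * (?R $$ (b, a) * ?R $$ (d, c)))"
      by (intro sum.cong[OF refl] rot)
    also have "\<dots> = mat_trace (S ^\<^sub>m (2 * Suc q))"
      unfolding tr4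
    proof (intro sum.cong refl)
      fix a c d b assume "a \<in> {..<m}" "c \<in> {..<m}" "d \<in> {..<m}" "b \<in> {..<m}"
      then show "S $$ (a, c) * S $$ (b, d) * (?R $$ (b, a) * ?R $$ (d, c))
          = S $$ (a, c) * ?R $$ (c, d) * S $$ (d, b) * ?R $$ (b, a)"
        using S_swap[of b d] R_swap[of d c] by simp
    qed
    finally show ?thesis .
  qed
  have 3: "(\<Sum>a<m. \<Sum>b<m. \<Sum>c<m. \<Sum>d<m. S $$ (a, d) * S $$ (b, c) * (?R $$ (b, a) * ?R $$ (d, c)))
      = mat_trace (S ^\<^sub>m (2 * Suc q))"
  proof -
    have "(\<Sum>a<m. \<Sum>b<m. \<Sum>c<m. \<Sum>d<m. S $$ (a, d) * S $$ (b, c) * (?R $$ (b, a) * ?R $$ (d, c)))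
        = (\<Sum>a<m. \<Sum>d<m. \<Sum>c<m. \<Sum>b<m. S $$ (a, d) * S $$ (b, c) * (?R $$ (b, a) * ?R $$ (d, c)))"
      by (rule sum.cong[OF refl], subst rot, rule sum.swap)
    also have "\<dots> = mat_trace (S ^\<^sub>m (2 * Suc q))"
      unfolding tr4
    proof (intro sum.cong refl)
      fix a d c b assume "a \<in> {..<m}" "d \<in> {..<m}" "c \<in> {..<m}" "b \<in> {..<m}"
      then show "S $$ (a, d) * S $$ (b, c) * (?R $$ (b, a) * ?R $$ (d, c))
          = S $$ (a, d) * ?R $$ (d, c) * S $$ (c, b) * ?R $$ (b, a)"
        using S_swap[of b c] by simp
    qed
    finally show ?thesis .
  qed
  show ?thesis unfolding distrib_right sum.distrib 1 2 3 by simp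
qed

text \<open>
  By cyclicity of the trace the common factor can be moved to the front of both products, after
  which the two remaining products are independent of it and of each other.
\<close>

lemma expectation_trace_prod_mult_common:
  assumes l: "distinct (us @ j # vs)" "set (us @ j # vs) \<subseteq> {..<k}"
    and l': "distinct (us' @ j # vs')" "set (us' @ j # vs') \<subseteq> {..<k}"
    and len: "length (us' @ j # vs') = length (us @ j # vs)"
    and dis: "set (us @ vs) \<inter> set (us' @ vs') = {}"
  defines "p \<equiv> length (us @ j # vs)"
  shows "expectation (\<lambda>\<omega>. trace_prod (us @ j # vs) \<omega> * trace_prod (us' @ j # vs') \<omega>)
       = (mat_trace (S ^\<^sub>m p))\<^sup>2 + 2 * mat_trace (S ^\<^sub>m (2 * p))"
proof -
  define q where "q = length (vs @ us)"
  have p: "p = Suc q" by (simp add: p_def q_def)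
  let ?P = "prod_entry (vs @ us)" and ?Q = "prod_entry (vs' @ us')" and ?R = "S ^\<^sub>m q"
  let ?Y = "\<lambda>a b c d \<omega>. y \<omega> j a * y \<omega> j b * y \<omega> j c * y \<omega> j d"
  let ?s = "\<lambda>a b c d. S $$ (a, b) * S $$ (c, d) + S $$ (a, c) * S $$ (b, d) + S $$ (a, d) * S $$ (b, c)"
  have j: "j < k" using l by simp
  have summand: "has_bochner_integral M (\<lambda>\<omega>. ?Y a b c d \<omega> * (?P b a \<omega> * ?Q d c \<omega>))
      (?s a b c d * (?R $$ (b, a) * ?R $$ (d, c)))"
    if abcd: "a < m" "b < m" "c < m" "d < m" for a b c d
  proof -
    have Y: "integrable_on_vars (cols {j}) (?Y a b c d)"
      unfolding integrable_on_vars_def using j abcd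
      by (intro conjI depends_on_mult depends_on_y integrable_y4) auto
    have us: "distinct (vs @ us)" "set (vs @ us) \<subseteq> {..<k}"
      and us': "distinct (vs' @ us')" "set (vs' @ us') \<subseteq> {..<k}" "length (vs' @ us') = q"
      using l l' len by (auto simp: q_def)
    have P: "integrable_on_vars (cols (set (vs @ us))) (?P b a)" "expectation (?P b a) = ?R $$ (b, a)"
      unfolding q_def
      by (rule integrable_on_vars_outer_prod[OF us abcd(2,1)], rule expectation_outer_prod[OF us abcd(2,1)])
    have Q: "integrable_on_vars (cols (set (vs' @ us'))) (?Q d c)" "expectation (?Q d c) = ?R $$ (d, c)"
      unfolding us'(3)[symmetric]
      by (rule integrable_on_vars_outer_prod[OF us'(1,2) abcd(4,3)],
          rule expectation_outer_prod[OF us'(1,2) abcd(4,3)])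
    have d1: "cols (set (vs @ us)) \<inter> cols (set (vs' @ us')) = {}" using dis by auto
    have d2: "cols {j} \<inter> (cols (set (vs @ us)) \<union> cols (set (vs' @ us'))) = {}" using l l' by auto
    note PQ = integrable_on_vars_mult[OF P(1) Q(1) d1]
    show ?thesis
      using integrable_on_varsD(2)[OF integrable_on_vars_mult[OF Y PQ d2]]
        expectation_mult_disjoint[OF Y PQ d2] expectation_mult_disjoint[OF P(1) Q(1) d1]
        expectation_y4[OF j abcd]
      by (simp add: has_bochner_integral_iff P(2) Q(2))
  qed
  have expand: "trace_prod (us @ j # vs) \<omega> * trace_prod (us' @ j # vs') \<omega>
      = (\<Sum>a<m. \<Sum>b<m. \<Sum>c<m. \<Sum>d<m. ?Y a b c d \<omega> * (?P b a \<omega> * ?Q d c \<omega>))" for \<omega>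
    unfolding mat_trace_outer_prod_rotate sum_sum_mult_sum_sum
    by (intro sum.cong refl) (simp only: mult_ac)
  have "has_bochner_integral M (\<lambda>\<omega>. trace_prod (us @ j # vs) \<omega> * trace_prod (us' @ j # vs') \<omega>)
      (\<Sum>a<m. \<Sum>b<m. \<Sum>c<m. \<Sum>d<m. ?s a b c d * (?R $$ (b, a) * ?R $$ (d, c)))"
    unfolding expand by (intro has_bochner_integral_sum summand) auto
  then show ?thesis
    unfolding sum_contract4 p by (rule has_bochner_integral_integral_eq)
qed

lemma variance_estimate:
  assumes p: "1 \<le> p" "p \<le> k" and k: "2 \<le> k"
  defines "\<zeta> \<equiv> 2 * mat_trace (S ^\<^sub>m (2 * p))" and "\<tau> \<equiv> mat_trace (S ^\<^sub>m p)"
  shows "\<bar>variance (\<lambda>\<omega>. (\<Sum>I | I \<subseteq> {..<k} \<and> card I = p. trace_prod (sorted_list_of_set I) \<omega>) / real (k choose p))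
          - real p ^ 2 * \<zeta> / real k\<bar>
       \<le> 2 * real p ^ 4 * (K ^ p + \<tau>\<^sup>2 + real p * \<bar>\<zeta>\<bar>) / real k ^ 2"
proof -
  define F where "F = {I. I \<subseteq> {..<k} \<and> card I = p}"
  define X where "X I = trace_prod (sorted_list_of_set I)" for I
  define N where "N = real (k choose p)"
  have N: "N > 0" using p by (simp add: N_def)
  have card_F: "real (card F) = N" unfolding F_def N_def by (simp add: n_subsets)
  have F: "finite I" "I \<noteq> {}" "distinct (sorted_list_of_set I)" "set (sorted_list_of_set I) \<subseteq> {..<k}"
    "length (sorted_list_of_set I) = p" "sorted_list_of_set I \<noteq> []" if "I \<in> F" for I
  proof -
    show fin: "finite I" and ne: "I \<noteq> {}" using that p by (auto simp: F_def intro: finite_subset)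
    show "distinct (sorted_list_of_set I)" "set (sorted_list_of_set I) \<subseteq> {..<k}"
      "length (sorted_list_of_set I) = p" using fin that by (auto simp: F_def)
    show "sorted_list_of_set I \<noteq> []" using fin ne by simp
  qed
  have X_int: "integrable M (X I)" and X_exp: "expectation (X I) = \<tau>" if "I \<in> F" for I
    using integrable_on_varsD(2)[OF integrable_on_vars_trace_prod[OF F(3,4)[OF that]]]
      expectation_trace_prod[OF F(3,4)[OF that]] F(5)[OF that]
    by (simp_all add: X_def \<tau>_def)
  have XX_int: "integrable M (\<lambda>\<omega>. X I \<omega> * X J \<omega>)"
    and XX_le: "\<bar>expectation (\<lambda>\<omega>. X I \<omega> * X J \<omega>)\<bar> \<le> K ^ p" if "I \<in> F" "J \<in> F" for I J
    using integrable_trace_prod_mult[of "sorted_list_of_set I" "sorted_list_of_set J"]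
      expectation_trace_prod_mult_le[of "sorted_list_of_set I" "sorted_list_of_set J"]
      F[OF that(1)] F[OF that(2)]
    by (simp_all add: X_def)
  define c where "c I J = expectation (\<lambda>\<omega>. X I \<omega> * X J \<omega>) - \<tau>\<^sup>2" for I J
  \<comment> \<open>Nonnegativity of \<open>K\<close> is read off from a second moment of column 0,
    which exists because \<open>k \<ge> 2\<close>.\<close>
  have "K = expectation (\<lambda>\<omega>. (gram m (y \<omega>) 0 0)\<^sup>2)"
    by (rule has_bochner_integral_integral_eq[OF has_bochner_integral_gram_square, symmetric]) (use k in simp)
  also have "\<dots> \<ge> 0" by simp
  finally have "0 \<le> K" .
  have bound: "\<bar>(\<Sum>I\<in>F. \<Sum>J\<in>F. c I J) / N\<^sup>2 - real p ^ 2 * \<zeta> / real k\<bar>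
      \<le> 2 * real p ^ 4 * (K ^ p + \<tau>\<^sup>2 + real p * \<bar>\<zeta>\<bar>) / real k ^ 2"
    unfolding F_def N_def
  proof (rule u_statistic_variance[OF p k], fold F_def)
    show "0 \<le> K ^ p + \<tau>\<^sup>2" using \<open>0 \<le> K\<close> by simp
  next
    fix I J assume IJ: "I \<in> F" "J \<in> F" "I \<inter> J = {}"
    then show "c I J = 0"
      using expectation_trace_prod_mult_disjoint[of "sorted_list_of_set I" "sorted_list_of_set J"]
        F[OF IJ(1)] F[OF IJ(2)]
      by (simp add: c_def X_def \<tau>_def power2_eq_square)
  next
    fix I J j assume IJ: "I \<in> F" "J \<in> F" "I \<inter> J = {j}"
    note FI = F[OF IJ(1)] and FJ = F[OF IJ(2)]
    have "j \<in> set (sorted_list_of_set I)" "j \<in> set (sorted_list_of_set J)" using IJ FI FJ by auto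
    then obtain us vs us' vs' where I: "sorted_list_of_set I = us @ j # vs"
        and J: "sorted_list_of_set J = us' @ j # vs'"
      by (meson split_list)
    have "I = set (us @ j # vs)" "J = set (us' @ j # vs')"
      unfolding I[symmetric] J[symmetric] using FI FJ by auto
    then have dis: "set (us @ vs) \<inter> set (us' @ vs') = {}"
      using IJ(3) FI(3) FJ(3) unfolding I J by auto
    have len: "length (us @ j # vs) = p" "length (us' @ j # vs') = length (us @ j # vs)"
      using FI(5) FJ(5) unfolding I J by simp_all
    \<comment> \<open>The pairing that closes both traces separately gives
      \<open>\<tau>\<^sup>2\<close>, which cancels against the centring in \<open>c\<close>.\<close>
    show "c I J = \<zeta>"
      using expectation_trace_prod_mult_common[OF FI(3,4)[unfolded I] FJ(3,4)[unfolded J] len(2) dis]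
      unfolding c_def X_def I J \<tau>_def \<zeta>_def len(1) by simp
  next
    fix I J assume IJ: "I \<in> F" "J \<in> F"
    have "\<bar>c I J\<bar> \<le> \<bar>expectation (\<lambda>\<omega>. X I \<omega> * X J \<omega>)\<bar> + \<bar>\<tau>\<^sup>2\<bar>"
      unfolding c_def by (rule abs_triangle_ineq4)
    then show "\<bar>c I J\<bar> \<le> K ^ p + \<tau>\<^sup>2" using XX_le[OF IJ] by simp
  qed
  let ?est = "\<lambda>\<omega>. (\<Sum>I\<in>F. X I \<omega>) / N"
  have mean: "expectation ?est = \<tau>"
    using N by (simp add: X_int X_exp card_F)
  have centred: "has_bochner_integral M (\<lambda>\<omega>. (X I \<omega> - \<tau>) * (X J \<omega> - \<tau>)) (c I J)"
    if IJ: "I \<in> F" "J \<in> F" for I J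
  proof -
    have "(\<lambda>\<omega>. (X I \<omega> - \<tau>) * (X J \<omega> - \<tau>)) = (\<lambda>\<omega>. X I \<omega> * X J \<omega> - \<tau> * X I \<omega> - \<tau> * X J \<omega> + \<tau>\<^sup>2)"
      by (simp add: algebra_simps power2_eq_square)
    then show ?thesis
      using XX_int[OF IJ] X_int[OF IJ(1)] X_int[OF IJ(2)] X_exp[OF IJ(1)] X_exp[OF IJ(2)]
      by (simp add: has_bochner_integral_iff c_def prob_space power2_eq_square)
  qed
  have "has_bochner_integral M (\<lambda>\<omega>. (\<Sum>I\<in>F. \<Sum>J\<in>F. (X I \<omega> - \<tau>) * (X J \<omega> - \<tau>)) / N\<^sup>2)
      ((\<Sum>I\<in>F. \<Sum>J\<in>F. c I J) / N\<^sup>2)"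
    by (intro has_bochner_integral_divide has_bochner_integral_sum centred)
  also have "(\<lambda>\<omega>. (\<Sum>I\<in>F. \<Sum>J\<in>F. (X I \<omega> - \<tau>) * (X J \<omega> - \<tau>)) / N\<^sup>2) = (\<lambda>\<omega>. (?est \<omega> - \<tau>)\<^sup>2)"
  proof
    fix \<omega>
    have "?est \<omega> - \<tau> = (\<Sum>I\<in>F. X I \<omega> - \<tau>) / N"
      using N by (simp add: sum_subtractf card_F diff_divide_distrib)
    then show "(\<Sum>I\<in>F. \<Sum>J\<in>F. (X I \<omega> - \<tau>) * (X J \<omega> - \<tau>)) / N\<^sup>2 = (?est \<omega> - \<tau>)\<^sup>2"
      by (simp add: power_divide power2_eq_square sum_product)
  qed
  finally have "variance ?est = (\<Sum>I\<in>F. \<Sum>J\<in>F. c I J) / N\<^sup>2"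
    unfolding mean by (rule has_bochner_integral_integral_eq)
  then show ?thesis using bound by (simp add: X_def F_def N_def)
qed

end

text \<open>The order of quantifiers carries the claim on the constant: \<open>C\<close> is fixed
  before the matrix, its dimensions and the sketches, and its argument is a multiset, hence
  symmetric. Each \<open>k\<close> has its own probability space, since sketches of different sizes
  need not be coupled.\<close>

theorem theorem2:
  fixes p :: nat
  assumes "p \<ge> 1"
  shows "\<exists>C :: real multiset \<Rightarrow> real.
           \<forall>m n A (M :: nat \<Rightarrow> 'w measure) \<Omega>.
             A \<in> carrier_mat m n \<longrightarrow>
             (\<forall>k\<ge>p. standard_gaussian_matrix n k (M k) (\<Omega> k)) \<longrightarrow>
             (\<forall>\<^sub>F k in sequentially.
                \<bar>prob_space.variance (M k) (\<lambda>\<omega>. schatten_estimator p A (\<Omega> k \<omega>))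
                   - 2 * real p ^ 2 * schatten_norm (4 * p) A ^ (4 * p) / real k\<bar>
                \<le> C (singular_values A) / real k ^ 2)"
proof -
  \<comment> \<open>Power sums standing in for traces: \<open>P (2 * q)\<close> at the singular
    values is the trace of \<open>S ^\<^sub>m q\<close> for \<open>q \<ge> 1\<close>. Under this
    dictionary \<open>(P 2)^2 + 2 * P 4\<close> is \<open>K\<close>, and \<open>C\<close> is the
    constant of \<open>variance_estimate\<close>.\<close>
  define P :: "nat \<Rightarrow> real multiset \<Rightarrow> real" where "P q s = (\<Sum>\<sigma>\<in>#s. \<sigma> ^ q)" for q s
  define C where "C s = 2 * real p ^ 4 * (((P 2 s)\<^sup>2 + 2 * P 4 s) ^ p + (P (2 * p) s)\<^sup>2
      + real p * \<bar>2 * P (4 * p) s\<bar>)" for s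
  have "\<bar>prob_space.variance (M k) (\<lambda>\<omega>. schatten_estimator p A (\<Omega> k \<omega>))
           - 2 * real p ^ 2 * schatten_norm (4 * p) A ^ (4 * p) / real k\<bar>
        \<le> C (singular_values A) / real k ^ 2"
    if A: "A \<in> carrier_mat m n" and G: "standard_gaussian_matrix n k (M k) (\<Omega> k)"
      and k: "k \<ge> p" "k \<ge> 2" for m n k A and M :: "nat \<Rightarrow> 'w measure" and \<Omega>
  proof -
    define g where "g = (\<lambda>(i, j) \<omega>. \<Omega> k \<omega> $$ (i, j))"
    have dim: "\<Omega> k \<omega> \<in> carrier_mat n k" if "\<omega> \<in> space (M k)" for \<omega>
      using G that by (simp add: standard_gaussian_matrix_def)
    interpret prob_space "M k"
      using G by (simp add: standard_gaussian_matrix_def)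
    interpret gaussian_sketch "M k" g n k A m
      by unfold_locales (use G A in \<open>auto simp: standard_gaussian_matrix_def g_def\<close>)
    \<comment> \<open>Equality on \<open>space M\<close> is enough, as the variance is an integral
      over that space.\<close>
    have est: "schatten_estimator p A (\<Omega> k \<omega>)
        = (\<Sum>I | I \<subseteq> {..<k} \<and> card I = p. trace_prod (sorted_list_of_set I) \<omega>) / real (k choose p)"
      if \<omega>: "\<omega> \<in> space (M k)" for \<omega>
    proof -
      have "(A * \<Omega> k \<omega>) $$ (a, j) = y \<omega> j a" if "a < m" "j < k" for a j
        using index_mult_mat_sum[OF A dim[OF \<omega>] that] unfolding y_def by (simp add: g_def)
      then have "outer_prod m (\<lambda>j a. (A * \<Omega> k \<omega>) $$ (a, j)) l = outer_prod m (y \<omega>) l"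
        if "set l \<subseteq> {..<k}" for l
        using that
      proof (induction l)
        case (Cons j l)
        then have "outer_mat m (\<lambda>j a. (A * \<Omega> k \<omega>) $$ (a, j)) j = outer_mat m (y \<omega>) j"
          unfolding outer_mat_def by (intro cong_mat) auto
        with Cons show ?case by simp
      qed simp
      then show ?thesis
        unfolding schatten_estimator_eq[OF A dim[OF \<omega>] assms]
        by (intro arg_cong2[of _ _ _ _ divide] sum.cong arg_cong[of _ _ mat_trace] refl)
           (auto simp: finite_subset[of _ "{..<k}"])
    qed
    have P: "P (2 * q) (singular_values A) = mat_trace (S ^\<^sub>m q)" if "q \<ge> 1" for q
      using sum_singular_values_pow[OF A that] by (simp add: P_def S_def)
    have "S ^\<^sub>m 1 = S" using left_mult_one_mat[OF S_carrier] by (simp add: carrier_matD[OF S_carrier])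
    then have P2: "P 2 (singular_values A) = mat_trace S" using P[of 1] by simp
    have P4p: "P (4 * p) (singular_values A) = mat_trace (S ^\<^sub>m (2 * p))"
      using P[of "2 * p"] assms by simp
    have "C (singular_values A)
        = 2 * real p ^ 4 * (K ^ p + (mat_trace (S ^\<^sub>m p))\<^sup>2 + real p * \<bar>2 * mat_trace (S ^\<^sub>m (2 * p))\<bar>)"
      using P[of 2] P[OF assms] by (simp add: C_def K_def P2 P4p)
    moreover have "schatten_norm (4 * p) A ^ (4 * p) = mat_trace (S ^\<^sub>m (2 * p))"
      using schatten_norm_pow[OF A, of "2 * p"] assms by (simp add: S_def)
    moreover have "variance (\<lambda>\<omega>. schatten_estimator p A (\<Omega> k \<omega>))
        = variance (\<lambda>\<omega>. (\<Sum>I | I \<subseteq> {..<k} \<and> card I = p. trace_prod (sorted_list_of_set I) \<omega>) / real (k choose p))"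
      using est by (simp cong: Bochner_Integration.integral_cong)
    ultimately show ?thesis
      using variance_estimate[OF assms k] by (simp add: mult_ac)
  qed
  then have "\<forall>\<^sub>F k in sequentially.
      \<bar>prob_space.variance (M k) (\<lambda>\<omega>. schatten_estimator p A (\<Omega> k \<omega>))
         - 2 * real p ^ 2 * schatten_norm (4 * p) A ^ (4 * p) / real k\<bar>
      \<le> C (singular_values A) / real k ^ 2"
    if "A \<in> carrier_mat m n" "\<forall>k\<ge>p. standard_gaussian_matrix n k (M k) (\<Omega> k)"
    for m n A and M :: "nat \<Rightarrow> 'w measure" and \<Omega>
    \<comment> \<open>The threshold combines \<open>k \<ge> p\<close>, where the sketch is assumed
      Gaussian and the binomial coefficient is positive, with \<open>k \<ge> 2\<close> from the
      count of pairs.\<close>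
    using that by (intro eventually_sequentiallyI[of "max p 2"]) auto
  then show ?thesis by blast
qed

end
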